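(* Let $\lambda\in\mathfrak h^*$ be a generic weight and $\mu,\mu'\in(\mathbb C^* )^r$. The Whittaker function $W_\lambda^{\mu,\mu'}(\phi)={}^{\mu'}_{\lambda}\langle w|\,e^{\sum_{i=1}^r\phi_ih_i}\,|w\rangle^{\mu}_{\lambda}$ is the following generating series for the partition functions of the path model with fixed endpoints: $$W_\lambda^{\mu,\mu'}(\phi)=\sum_{\beta\in Q_+}\Big(\prod_{i=1}^r(d_i\mu_i\mu_i')^{\beta_i}\Big)\,e^{(\lambda-\beta|\phi)}\,Z_\beta ,$$ where $\phi=\sum_{i=1}^r\phi_i\alpha_i^\vee$, $\beta=\sum_i\beta_i\alpha_i$, and $Z_\beta=\sum_{\mathbf p\in\mathcal P_\beta}x(\mathbf p)$ with vertex weights $v(\beta)=(\lambda+\rho|\beta)-\frac12(\beta|\beta)$.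
   Context: Lie algebra data. $\mathfrak g=\mathfrak n_-\oplus\mathfrak h\oplus\mathfrak n_+$ is a finite-dimensional simple complex Lie algebra of rank $r$ with simple roots $\alpha_1,\dots,\alpha_r$, Cartan matrix $C$, and Chevalley generators $e_i\in\mathfrak n_+$, $f_i\in\mathfrak n_-$, $h_i\in\mathfrak h$ satisfying $[h_i,h_j]=0$, $[h_i,e_j]=C_{j,i}e_j$, $[h_i,f_j]=-C_{j,i}f_j$, $[e_i,f_j]=\delta_{i,j}h_j$ and the Serre relations. The $d_i$ are the coprime positive integers with $C_{i,j}d_j=C_{j,i}d_i$. The co-roots $\alpha_i^\vee\in\mathfrak h^*$ are defined by $\alpha_i=d_i\alpha_i^\vee$, and $(\cdot|\cdot)$ is the symmetric bilinear form on $\mathfrak h^*$ with $(\alpha_i|\alpha_j^\vee)=C_{i,j}$. One has $h_j(\lambda)=(\lambda|\alpha_j^\vee)$ for $\lambda\in\mathfrak h^*$; $(\omega_i|\alpha_j^\vee)=\delta_{i,j}$; $\rho=\sum_{i=1}^r\omega_i$; $Q_+=\bigoplus_{i=1}^r\mathbb Z_{\ge0}\alpha_i$. Verma module and dual. $V_\lambda=U(\mathfrak n_-)|\lambda\rangle$ is the (irreducible) Verma module with highest weight vector $|\lambda\rangle$; its completion is $\prod_{\beta\in Q_+}V[\lambda-\beta]$ (product of weight spaces). The dual right module is $V_\lambda^*=\langle\lambda|U(\mathfrak n_+)$ with $\langle\lambda|\mathfrak n_-=0$, $\langle\lambda|h=h(\lambda)\langle\lambda|$, $\langle\lambda|\lambda\rangle=1$,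 similarly completed; the pairing is $(\langle\lambda|a)(b|\lambda\rangle)=\langle\lambda|ab|\lambda\rangle$. Whittaker vectors. $|w\rangle=|w\rangle_\lambda^\mu$ is the unique element of the completion of $V_\lambda$ with $\langle\lambda|w\rangle=1$ and $e_i|w\rangle=\mu_i|w\rangle$ for all $i$. ${}^{\mu'}_\lambda\langle w|$ is the unique element of the completion of $V_\lambda^*$ with $\langle w|\lambda\rangle=1$ and $\langle w|f_i=\mu_i'\langle w|$ for all $i$. The $\phi_i$ are formal variables; the matrix element defining $W_\lambda^{\mu,\mu'}(\phi)$ is the formal series obtained by summing over $\beta\in Q_+$ the pairings of the components of weight $\lambda-\beta$, on which $e^{\sum_i\phi_ih_i}$ acts by $e^{(\lambda-\beta|\phi)}$. Paths. For $\beta\in Q_+$, $\mathcal P_\beta$ is the set of sequences $\mathbf p=(p_0,\dots,p_N)$ in $Q_+$ with $p_0=0$, $p_N=\beta$ and each $p_k-p_{k-1}$ a simple root; $x(\mathbf p)=\prod_{k=1}^N\frac1{v(p_k)}$ (equal to $1$ for the trivial path). "$\lambda$ generic" means that $V_\lambda$ is irreducible and $v(\beta)\neq0$ for all $\beta\in Q_+\setminus\{0\}$, with $v(\beta)=(\lambda+\rho|\beta)-\frac12(\beta|\beta)$. *)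

theory Defs
  imports "HOL-Analysis.Analysis" "HOL-Library.Poly_Mapping"
begin

section \<open>Complex Lie algebras\<close>

class complex_lie_algebra = ab_group_add +
  fixes scaleC :: "complex \<Rightarrow> 'a \<Rightarrow> 'a"
    and lie :: "'a \<Rightarrow> 'a \<Rightarrow> 'a"
  assumes scaleC_add_right: "scaleC a (x + y) = scaleC a x + scaleC a y"
    and scaleC_add_left: "scaleC (a + b) x = scaleC a x + scaleC b x"
    and scaleC_scaleC: "scaleC a (scaleC b x) = scaleC (a * b) x"
    and scaleC_one: "scaleC 1 x = x"
    and lie_add_left: "lie (x + y) z = lie x z + lie y z"
    and lie_add_right: "lie x (y + z) = lie x y + lie x z"
    and lie_scaleC_left: "lie (scaleC a x) y = scaleC a (lie x y)"
    and lie_scaleC_right: "lie x (scaleC a y) = scaleC a (lie x y)"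
    and lie_self: "lie x x = 0"
    and jacobi: "lie x (lie y z) + lie y (lie z x) + lie z (lie x y) = 0"

interpretation clie: vector_space "scaleC :: complex \<Rightarrow> 'a \<Rightarrow> 'a::complex_lie_algebra"
  by unfold_locales
    (simp_all add: scaleC_add_right scaleC_add_left scaleC_scaleC scaleC_one)

definition lie_subalgebra :: "'g::complex_lie_algebra set \<Rightarrow> bool" where
  "lie_subalgebra H \<longleftrightarrow> clie.subspace H \<and> (\<forall>x\<in>H. \<forall>y\<in>H. lie x y \<in> H)"

definition lie_ideal :: "'g::complex_lie_algebra set \<Rightarrow> bool" where
  "lie_ideal I \<longleftrightarrow> clie.subspace I \<and> (\<forall>x. \<forall>y\<in>I. lie x y \<in> I)"

definition fin_dim_lie :: "'g::complex_lie_algebra itself \<Rightarrow> bool" where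
  "fin_dim_lie _ \<longleftrightarrow> (\<exists>B::'g set. finite B \<and> clie.span B = UNIV)"

definition simple_lie :: "'g::complex_lie_algebra itself \<Rightarrow> bool" where
  "simple_lie _ \<longleftrightarrow> (\<exists>x y::'g. lie x y \<noteq> 0) \<and>
     (\<forall>I::'g set. lie_ideal I \<longrightarrow> I = {0} \<or> I = UNIV)"


section \<open>Universal enveloping algebra\<close>

text \<open>The free associative algebra on the underlying set of the Lie algebra is the monoid
  algebra of the free monoid of words; the enveloping algebra is its quotient by the linear
  structure of the Lie algebra and by \<open>[x,y] = x y - y x\<close>.\<close>

datatype 'a free_word = Free_Word (letters: "'a list")

instantiation free_word :: (type) monoid_add
begin

definition zero_free_word :: "'a free_word" where
  "0 = Free_Word []"

definition plus_free_word :: "'a free_word \<Rightarrow> 'a free_word \<Rightarrow> 'a free_word" where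
  "u + v = Free_Word (letters u @ letters v)"

instance
  by standard (simp_all add: zero_free_word_def plus_free_word_def)

end

type_synonym 'a free_alg = "'a free_word \<Rightarrow>\<^sub>0 complex"

definition free_gen :: "'a \<Rightarrow> 'a free_alg" where
  "free_gen x = Poly_Mapping.single (Free_Word [x]) 1"

definition free_const :: "complex \<Rightarrow> 'a free_alg" where
  "free_const c = Poly_Mapping.single 0 c"

inductive uea_eq :: "'g::complex_lie_algebra free_alg \<Rightarrow> 'g free_alg \<Rightarrow> bool" where
  refl: "uea_eq a a"
| sym: "uea_eq a b \<Longrightarrow> uea_eq b a"
| trans: "uea_eq a b \<Longrightarrow> uea_eq b c \<Longrightarrow> uea_eq a c"
| add: "uea_eq a b \<Longrightarrow> uea_eq c d \<Longrightarrow> uea_eq (a + c) (b + d)"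
| mult: "uea_eq a b \<Longrightarrow> uea_eq c d \<Longrightarrow> uea_eq (a * c) (b * d)"
| gen_add: "uea_eq (free_gen (x + y)) (free_gen x + free_gen y)"
| gen_scale: "uea_eq (free_gen (scaleC k x)) (free_const k * free_gen x)"
| gen_lie: "uea_eq (free_gen (lie x y)) (free_gen x * free_gen y - free_gen y * free_gen x)"

lemma uea_eq_uminus: "uea_eq a b \<Longrightarrow> uea_eq (- a) (- b)"
  using uea_eq.mult[OF uea_eq.refl[of "- 1"], of a b] by simp

quotient_type (overloaded) 'g uea = "('g::complex_lie_algebra) free_alg" / uea_eq
  by (intro equivpI reflpI sympI transpI) (fact uea_eq.refl uea_eq.sym uea_eq.trans)+

instantiation uea :: (complex_lie_algebra) "{ring, monoid_mult}"
begin

lift_definition zero_uea :: "'a uea" is 0 .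
lift_definition one_uea :: "'a uea" is 1 .
lift_definition plus_uea :: "'a uea \<Rightarrow> 'a uea \<Rightarrow> 'a uea" is "(+)"
  by (rule uea_eq.add)
lift_definition uminus_uea :: "'a uea \<Rightarrow> 'a uea" is uminus
  by (rule uea_eq_uminus)
lift_definition minus_uea :: "'a uea \<Rightarrow> 'a uea \<Rightarrow> 'a uea" is "(-)"
  using uea_eq.add uea_eq_uminus by fastforce
lift_definition times_uea :: "'a uea \<Rightarrow> 'a uea \<Rightarrow> 'a uea" is "(*)"
  by (rule uea_eq.mult)

instance
  by standard (transfer; simp add: algebra_simps uea_eq.refl)+

end

lift_definition uea_gen :: "'g::complex_lie_algebra \<Rightarrow> 'g uea" is free_gen .
lift_definition uea_const :: "complex \<Rightarrow> 'g::complex_lie_algebra uea" is free_const .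

definition left_ideal :: "'g::complex_lie_algebra uea set \<Rightarrow> bool" where
  "left_ideal I \<longleftrightarrow> 0 \<in> I \<and> (\<forall>a\<in>I. \<forall>b\<in>I. a + b \<in> I) \<and> (\<forall>u. \<forall>a\<in>I. u * a \<in> I)"

definition right_ideal :: "'g::complex_lie_algebra uea set \<Rightarrow> bool" where
  "right_ideal I \<longleftrightarrow> 0 \<in> I \<and> (\<forall>a\<in>I. \<forall>b\<in>I. a + b \<in> I) \<and> (\<forall>u. \<forall>a\<in>I. a * u \<in> I)"


section \<open>Chevalley data, roots and weights\<close>

text \<open>The index type \<open>'n\<close> has cardinality the rank.\<close>

record ('g, 'n) chevalley =
  ee :: "'n \<Rightarrow> 'g"
  ff :: "'n \<Rightarrow> 'g"
  hh :: "'n \<Rightarrow> 'g"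
  cartan :: "'n \<Rightarrow> 'n \<Rightarrow> int"
  dd :: "'n \<Rightarrow> nat"

definition nplus :: "('g::complex_lie_algebra, 'n::finite) chevalley \<Rightarrow> 'g set" where
  "nplus G = lie_subalgebra hull range (ee G)"

definition nminus :: "('g::complex_lie_algebra, 'n::finite) chevalley \<Rightarrow> 'g set" where
  "nminus G = lie_subalgebra hull range (ff G)"

definition hsub :: "('g::complex_lie_algebra, 'n::finite) chevalley \<Rightarrow> 'g set" where
  "hsub G = clie.span (range (hh G))"

text \<open>Index convention: \<open>[h i, e j] = C j i e j\<close>, so that \<open>C j i\<close> is the value of the simple
  root \<open>\<alpha> j\<close> on \<open>h i\<close>; this is the transpose of the convention used in part of the literature,
  and the Serre exponents are transposed accordingly.\<close>

definition chevalley_data :: "('g::complex_lie_algebra, 'n::finite) chevalley \<Rightarrow> bool" where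
  "chevalley_data G \<longleftrightarrow>
     fin_dim_lie TYPE('g) \<and> simple_lie TYPE('g) \<and>
     inj (hh G) \<and> clie.independent (range (hh G)) \<and>
     (\<forall>x. \<exists>!t. t \<in> nminus G \<times> hsub G \<times> nplus G \<and> x = fst t + fst (snd t) + snd (snd t)) \<and>
     (\<forall>i. cartan G i i = 2) \<and>
     (\<forall>i j. i \<noteq> j \<longrightarrow> cartan G i j \<le> 0) \<and>
     (\<forall>i j. cartan G i j = 0 \<longrightarrow> cartan G j i = 0) \<and>
     (\<forall>i j. lie (hh G i) (hh G j) = 0) \<and>
     (\<forall>i j. lie (hh G i) (ee G j) = scaleC (of_int (cartan G j i)) (ee G j)) \<and>
     (\<forall>i j. lie (hh G i) (ff G j) = - scaleC (of_int (cartan G j i)) (ff G j)) \<and>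
     (\<forall>i j. lie (ee G i) (ff G j) = (if i = j then hh G j else 0)) \<and>
     (\<forall>i j. i \<noteq> j \<longrightarrow> (lie (ee G i) ^^ nat (1 - cartan G j i)) (ee G j) = 0) \<and>
     (\<forall>i j. i \<noteq> j \<longrightarrow> (lie (ff G i) ^^ nat (1 - cartan G j i)) (ff G j) = 0) \<and>
     (\<forall>i. dd G i > 0) \<and> Gcd (range (dd G)) = 1 \<and>
     (\<forall>i j. cartan G i j * int (dd G j) = cartan G j i * int (dd G i))"

text \<open>A weight, i.e. a linear functional \<open>lam\<close> on the Cartan subalgebra, is stored through its
  values \<open>lam $ i\<close> on the basis \<open>h i\<close>.\<close>

type_synonym 'n weight = "complex ^ 'n"

definition simple_root :: "('g, 'n::finite) chevalley \<Rightarrow> 'n \<Rightarrow> 'n weight" where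
  "simple_root G i = (\<chi> j. of_int (cartan G i j))"

text \<open>The co-roots are elements of the dual of the Cartan subalgebra:
  \<open>\<alpha> i = d i \<alpha>\<^sup>\<or> i\<close>.\<close>

definition coroot :: "('g, 'n::finite) chevalley \<Rightarrow> 'n \<Rightarrow> 'n weight" where
  "coroot G i = (1 / of_nat (dd G i)) *s simple_root G i"

definition is_weight_form ::
    "('g, 'n::finite) chevalley \<Rightarrow> ('n weight \<Rightarrow> 'n weight \<Rightarrow> complex) \<Rightarrow> bool" where
  "is_weight_form G B \<longleftrightarrow>
     (\<forall>x. Vector_Spaces.linear (*s) (*) (B x)) \<and> (\<forall>x y. B x y = B y x) \<and>
     (\<forall>i j. B (simple_root G i) (coroot G j) = of_int (cartan G i j))"

definition wform :: "('g, 'n::finite) chevalley \<Rightarrow> 'n weight \<Rightarrow> 'n weight \<Rightarrow> complex" where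
  "wform G = (THE B. is_weight_form G B)"

definition fund_weight :: "'n::finite \<Rightarrow> 'n weight" where
  "fund_weight i = axis i 1"

definition rho :: "'n::finite weight" where
  "rho = (\<Sum>i\<in>UNIV. fund_weight i)"

text \<open>An element \<open>\<Sum>i. \<beta> i \<alpha> i\<close> of \<open>Q\<^sub>+\<close> is stored through its coefficients
  \<open>\<beta> :: 'n \<Rightarrow> nat\<close>.\<close>

definition qwt :: "('g, 'n::finite) chevalley \<Rightarrow> ('n \<Rightarrow> nat) \<Rightarrow> 'n weight" where
  "qwt G \<beta> = (\<Sum>i\<in>UNIV. of_nat (\<beta> i) *s simple_root G i)"

definition qstep :: "'n \<Rightarrow> ('n \<Rightarrow> nat) \<Rightarrow> 'n \<Rightarrow> nat" where
  "qstep i \<beta> = \<beta>(i := Suc (\<beta> i))"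


section \<open>Verma modules\<close>

text \<open>The Verma module is the quotient of the enveloping algebra \<open>U\<close> by the left ideal generated
  by \<open>n\<^sub>+\<close> and the \<open>h i - \<lambda>(h i)\<close>; its elements are cosets, \<open>ket G lam u\<close> being \<open>u|\<lambda>\<rangle>\<close>.
  Dually, \<open>bra G lam u\<close> is \<open>\<langle>\<lambda>|u\<close>.\<close>

definition verma_ideal ::
    "('g::complex_lie_algebra, 'n::finite) chevalley \<Rightarrow> 'n weight \<Rightarrow> 'g uea set" where
  "verma_ideal G lam = left_ideal hull
     (uea_gen ` nplus G \<union> range (\<lambda>i. uea_gen (hh G i) - uea_const (lam $ i)))"

definition dual_verma_ideal ::
    "('g::complex_lie_algebra, 'n::finite) chevalley \<Rightarrow> 'n weight \<Rightarrow> 'g uea set" where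
  "dual_verma_ideal G lam = right_ideal hull
     (uea_gen ` nminus G \<union> range (\<lambda>i. uea_gen (hh G i) - uea_const (lam $ i)))"

definition ket ::
    "('g::complex_lie_algebra, 'n::finite) chevalley \<Rightarrow> 'n weight \<Rightarrow> 'g uea \<Rightarrow> 'g uea set" where
  "ket G lam u = {a. a - u \<in> verma_ideal G lam}"

definition bra ::
    "('g::complex_lie_algebra, 'n::finite) chevalley \<Rightarrow> 'n weight \<Rightarrow> 'g uea \<Rightarrow> 'g uea set" where
  "bra G lam u = {a. a - u \<in> dual_verma_ideal G lam}"

definition verma ::
    "('g::complex_lie_algebra, 'n::finite) chevalley \<Rightarrow> 'n weight \<Rightarrow> 'g uea set set" where
  "verma G lam = range (ket G lam)"

definition dual_verma ::
    "('g::complex_lie_algebra, 'n::finite) chevalley \<Rightarrow> 'n weight \<Rightarrow> 'g uea set set" where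
  "dual_verma G lam = range (bra G lam)"

definition ket_add :: "('g::complex_lie_algebra, 'n::finite) chevalley \<Rightarrow> 'n weight \<Rightarrow>
    'g uea set \<Rightarrow> 'g uea set \<Rightarrow> 'g uea set" where
  "ket_add G lam S T = (\<Union>a\<in>S. \<Union>b\<in>T. ket G lam (a + b))"

definition ket_act :: "('g::complex_lie_algebra, 'n::finite) chevalley \<Rightarrow> 'n weight \<Rightarrow>
    'g uea \<Rightarrow> 'g uea set \<Rightarrow> 'g uea set" where
  "ket_act G lam u S = (\<Union>a\<in>S. ket G lam (u * a))"

definition bra_act :: "('g::complex_lie_algebra, 'n::finite) chevalley \<Rightarrow> 'n weight \<Rightarrow>
    'g uea set \<Rightarrow> 'g uea \<Rightarrow> 'g uea set" where
  "bra_act G lam S u = (\<Union>a\<in>S. bra G lam (a * u))"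

definition verma_submodule :: "('g::complex_lie_algebra, 'n::finite) chevalley \<Rightarrow> 'n weight \<Rightarrow>
    'g uea set set \<Rightarrow> bool" where
  "verma_submodule G lam N \<longleftrightarrow> N \<subseteq> verma G lam \<and> ket G lam 0 \<in> N \<and>
     (\<forall>S\<in>N. \<forall>T\<in>N. ket_add G lam S T \<in> N) \<and> (\<forall>u. \<forall>S\<in>N. ket_act G lam u S \<in> N)"

definition verma_irreducible ::
    "('g::complex_lie_algebra, 'n::finite) chevalley \<Rightarrow> 'n weight \<Rightarrow> bool" where
  "verma_irreducible G lam \<longleftrightarrow> verma G lam \<noteq> {ket G lam 0} \<and>
     (\<forall>N. verma_submodule G lam N \<longrightarrow> N = {ket G lam 0} \<or> N = verma G lam)"

text \<open>\<open>vev G lam u\<close> is \<open>\<langle>\<lambda>|u|\<lambda>\<rangle>\<close>, computed by the rules \<open>n\<^sub>+|\<lambda>\<rangle> = 0\<close>, \<open>\<langle>\<lambda>|n\<^sub>- = 0\<close>,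
  \<open>h|\<lambda>\<rangle> = \<lambda>(h)|\<lambda>\<rangle>\<close>, \<open>\<langle>\<lambda>|h = \<lambda>(h)\<langle>\<lambda>|\<close> and \<open>\<langle>\<lambda>|\<lambda>\<rangle> = 1\<close>.\<close>

definition vev ::
    "('g::complex_lie_algebra, 'n::finite) chevalley \<Rightarrow> 'n weight \<Rightarrow> 'g uea \<Rightarrow> complex" where
  "vev G lam u = (THE c. \<exists>l\<in>verma_ideal G lam. \<exists>r\<in>dual_verma_ideal G lam. u = uea_const c + l + r)"

definition verma_pairing :: "('g::complex_lie_algebra, 'n::finite) chevalley \<Rightarrow> 'n weight \<Rightarrow>
    'g uea set \<Rightarrow> 'g uea set \<Rightarrow> complex" where
  "verma_pairing G lam T S =
     (THE c. \<exists>a b. T = bra G lam a \<and> S = ket G lam b \<and> c = vev G lam (a * b))"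

definition ket_weight_space :: "('g::complex_lie_algebra, 'n::finite) chevalley \<Rightarrow> 'n weight \<Rightarrow>
    'n weight \<Rightarrow> 'g uea set set" where
  "ket_weight_space G lam \<nu> = {S \<in> verma G lam.
     \<forall>i. ket_act G lam (uea_gen (hh G i)) S = ket_act G lam (uea_const (\<nu> $ i)) S}"

definition bra_weight_space :: "('g::complex_lie_algebra, 'n::finite) chevalley \<Rightarrow> 'n weight \<Rightarrow>
    'n weight \<Rightarrow> 'g uea set set" where
  "bra_weight_space G lam \<nu> = {T \<in> dual_verma G lam.
     \<forall>i. bra_act G lam T (uea_gen (hh G i)) = bra_act G lam T (uea_const (\<nu> $ i))}"

text \<open>An element of a completion is the family, indexed by \<open>Q\<^sub>+\<close>, of its components of weight
  \<open>\<lambda> - \<beta>\<close>.\<close>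

definition verma_completion :: "('g::complex_lie_algebra, 'n::finite) chevalley \<Rightarrow> 'n weight \<Rightarrow>
    (('n \<Rightarrow> nat) \<Rightarrow> 'g uea set) set" where
  "verma_completion G lam = {w. \<forall>\<beta>. w \<beta> \<in> ket_weight_space G lam (lam - qwt G \<beta>)}"

definition dual_verma_completion :: "('g::complex_lie_algebra, 'n::finite) chevalley \<Rightarrow>
    'n weight \<Rightarrow> (('n \<Rightarrow> nat) \<Rightarrow> 'g uea set) set" where
  "dual_verma_completion G lam = {w. \<forall>\<beta>. w \<beta> \<in> bra_weight_space G lam (lam - qwt G \<beta>)}"


section \<open>Whittaker vectors and the Whittaker function\<close>

text \<open>\<open>e i\<close> maps the component of weight \<open>\<lambda> - \<beta> - \<alpha> i\<close> to weight \<open>\<lambda> - \<beta>\<close>, and so does \<open>f i\<close>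
  acting from the right on the dual module. Since \<open>\<langle>\<lambda>|\<close> and \<open>|\<lambda>\<rangle>\<close> have weight \<open>\<lambda>\<close>, only the
  component at \<open>0\<close> enters the normalization.\<close>

definition whittaker_ket :: "('g::complex_lie_algebra, 'n::finite) chevalley \<Rightarrow> 'n weight \<Rightarrow>
    ('n \<Rightarrow> complex) \<Rightarrow> (('n \<Rightarrow> nat) \<Rightarrow> 'g uea set) \<Rightarrow> bool" where
  "whittaker_ket G lam \<mu> w \<longleftrightarrow> w \<in> verma_completion G lam \<and>
     verma_pairing G lam (bra G lam 1) (w (\<lambda>_. 0)) = 1 \<and>
     (\<forall>i \<beta>. ket_act G lam (uea_gen (ee G i)) (w (qstep i \<beta>)) =
            ket_act G lam (uea_const (\<mu> i)) (w \<beta>))"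

definition whittaker_bra :: "('g::complex_lie_algebra, 'n::finite) chevalley \<Rightarrow> 'n weight \<Rightarrow>
    ('n \<Rightarrow> complex) \<Rightarrow> (('n \<Rightarrow> nat) \<Rightarrow> 'g uea set) \<Rightarrow> bool" where
  "whittaker_bra G lam \<mu> w \<longleftrightarrow> w \<in> dual_verma_completion G lam \<and>
     verma_pairing G lam (w (\<lambda>_. 0)) (ket G lam 1) = 1 \<and>
     (\<forall>i \<beta>. bra_act G lam (w (qstep i \<beta>)) (uea_gen (ff G i)) =
            bra_act G lam (w \<beta>) (uea_const (\<mu> i)))"

text \<open>A linear form \<open>\<Sum>i. l i \<phi> i\<close> in the formal variables \<open>\<phi> i\<close> is stored through its
  coefficients \<open>l $ i\<close>. A formal series of exponentials \<open>e\<^sup>l\<close> is stored as the function taking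
  \<open>l\<close> to the coefficient of \<open>e\<^sup>l\<close>; \<open>exp_series a l\<close> is \<open>\<Sum>\<beta>. a \<beta> e\<^bsup>l \<beta>\<^esup>\<close>, a locally finite
  sum when \<open>l\<close> has finite fibres.\<close>

definition formal_exp :: "complex ^ 'n \<Rightarrow> complex ^ 'n \<Rightarrow> complex" where
  "formal_exp l = (\<lambda>k. if k = l then 1 else 0)"

definition exp_series ::
    "(('n \<Rightarrow> nat) \<Rightarrow> complex) \<Rightarrow> (('n \<Rightarrow> nat) \<Rightarrow> complex ^ 'n) \<Rightarrow> complex ^ 'n \<Rightarrow> complex" where
  "exp_series a l = (\<lambda>k. Sum_any (\<lambda>\<beta>. a \<beta> * formal_exp (l \<beta>) k))"

text \<open>\<open>\<Sum>i. \<phi> i h i\<close> acts on vectors of weight \<open>\<nu>\<close> by the linear form with coefficients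
  \<open>\<nu> $ i\<close>, so the matrix element of its exponential is the following series.\<close>

definition whittaker_function :: "('g::complex_lie_algebra, 'n::finite) chevalley \<Rightarrow> 'n weight \<Rightarrow>
    (('n \<Rightarrow> nat) \<Rightarrow> 'g uea set) \<Rightarrow> (('n \<Rightarrow> nat) \<Rightarrow> 'g uea set) \<Rightarrow> complex ^ 'n \<Rightarrow> complex" where
  "whittaker_function G lam w' w =
     exp_series (\<lambda>\<beta>. verma_pairing G lam (w' \<beta>) (w \<beta>)) (\<lambda>\<beta>. lam - qwt G \<beta>)"

text \<open>\<open>(\<nu>|\<phi>)\<close> for \<open>\<phi> = \<Sum>i. \<phi> i \<alpha>\<^sup>\<or> i\<close>, as a linear form in the \<open>\<phi> i\<close>.\<close>

definition wform_phi :: "('g, 'n::finite) chevalley \<Rightarrow> 'n weight \<Rightarrow> complex ^ 'n" where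
  "wform_phi G \<nu> = (\<chi> i. wform G \<nu> (coroot G i))"


section \<open>The path model\<close>

definition vertex_weight ::
    "('g, 'n::finite) chevalley \<Rightarrow> 'n weight \<Rightarrow> ('n \<Rightarrow> nat) \<Rightarrow> complex" where
  "vertex_weight G lam \<beta> =
     wform G (lam + rho) (qwt G \<beta>) - 1 / 2 * wform G (qwt G \<beta>) (qwt G \<beta>)"

definition paths :: "('n \<Rightarrow> nat) \<Rightarrow> ('n \<Rightarrow> nat) list set" where
  "paths \<beta> = {p. p \<noteq> [] \<and> hd p = (\<lambda>_. 0) \<and> last p = \<beta> \<and>
     successively (\<lambda>a b. \<exists>i. b = qstep i a) p}"

definition path_weight ::
    "('g, 'n::finite) chevalley \<Rightarrow> 'n weight \<Rightarrow> ('n \<Rightarrow> nat) list \<Rightarrow> complex" where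
  "path_weight G lam p = (\<Prod>k=1..<length p. 1 / vertex_weight G lam (p ! k))"

definition path_partition ::
    "('g, 'n::finite) chevalley \<Rightarrow> 'n weight \<Rightarrow> ('n \<Rightarrow> nat) \<Rightarrow> complex" where
  "path_partition G lam \<beta> = (\<Sum>p\<in>paths \<beta>. path_weight G lam p)"

definition generic_weight ::
    "('g::complex_lie_algebra, 'n::finite) chevalley \<Rightarrow> 'n weight \<Rightarrow> bool" where
  "generic_weight G lam \<longleftrightarrow> verma_irreducible G lam \<and>
     (\<forall>\<beta>. \<beta> \<noteq> (\<lambda>_. 0) \<longrightarrow> vertex_weight G lam \<beta> \<noteq> 0)"

end

theory Submission
  imports Defs
begin

text \<open>
  For a Whittaker vector with components \<open>w\<^sub>\<beta>\<close>, the difference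
  \<open>v(\<beta>) w\<^sub>\<beta> - \<Sum>i. d\<^sub>i \<mu>\<^sub>i f\<^sub>i w\<^bsub>\<beta> - \<alpha>\<^sub>i\<^esub>\<close> is, by induction on \<open>\<beta>\<close>, annihilated by all \<open>e\<^sub>j\<close>. Its
  weight is \<open>\<lambda> - \<beta>\<close>, so it vanishes by irreducibility of the Verma module. Pairing this identity
  with the dual Whittaker vector turns \<open>f\<^sub>i\<close> into \<open>\<mu>'\<^sub>i\<close> and gives the recursion satisfied by the
  path partition functions (split a path at its last step).

  Neither the Casimir element nor the Poincare-Birkhoff-Witt theorem is needed: irreducibility
  makes the Verma module nonzero, its weight \<open>\<lambda>\<close> does not occur among the \<open>\<lambda> - \<beta>\<close> with
  \<open>\<beta> \<noteq> 0\<close> because the Cartan matrix is invertible, and so \<open>\<langle>\<lambda>|u|\<lambda>\<rangle>\<close> is well defined as the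
  component of \<open>u|\<lambda>\<rangle>\<close> along \<open>|\<lambda>\<rangle>\<close>.
\<close>

section \<open>Lattice paths\<close>

text \<open>The value at the predecessor \<beta> - \<alpha>_i, extended by 0 when that vertex leaves
  Q_+. The default lets sums over predecessors run over all indices.\<close>

definition lower :: "'n \<Rightarrow> (('n \<Rightarrow> nat) \<Rightarrow> 'a::zero) \<Rightarrow> ('n \<Rightarrow> nat) \<Rightarrow> 'a" where
  "lower i f \<beta> = (if \<beta> i = 0 then 0 else f (\<beta>(i := \<beta> i - 1)))"

lemma lower_qstep [simp]: "lower i f (qstep i \<beta>) = f \<beta>"
  by (simp add: lower_def qstep_def)

lemma lower_commute: "lower i (lower j f) = lower j (lower i f)"
  by (cases "i = j") (auto simp: lower_def fun_eq_iff fun_upd_twist)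

lemma lower_eq_0: "\<beta> i = 0 \<Longrightarrow> lower i f \<beta> = 0"
  by (simp add: lower_def)

lemma lower_step: "\<beta> = qstep i \<gamma> \<Longrightarrow> lower i f \<beta> = f \<gamma>"
  by simp

text \<open>Replaces truncated subtraction by \<open>qstep\<close>: either there is no i-th
  predecessor, or the predecessor gets a name.\<close>

lemma lower_cases [case_names zero step]:
  obtains "\<beta> i = 0" | \<gamma> where "\<beta> = qstep i \<gamma>"
proof (cases "\<beta> i = 0")
  case True
  then show ?thesis using that(1) by simp
next
  case False
  then have "\<beta> = qstep i (\<beta>(i := \<beta> i - 1))" by (simp add: qstep_def)
  then show ?thesis by (rule that(2))
qed

lemma qstep_neq_0: "qstep i \<beta> \<noteq> (\<lambda>_. 0)"
  by (metis fun_upd_same nat.distinct(1) qstep_def)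

lemma sum_qstep: "(\<Sum>k\<in>UNIV. qstep i \<beta> k) = Suc (\<Sum>k\<in>UNIV. \<beta> k)" for i :: "'n::finite"
proof -
  have "qstep i \<beta> k = \<beta> k + (if k = i then 1 else 0)" for k
    by (simp add: qstep_def)
  then show ?thesis by (simp add: sum.distrib)
qed

lemma prod_qstep: "(\<Prod>k\<in>UNIV. a k ^ qstep i \<beta> k) = a i * (\<Prod>k\<in>UNIV. a k ^ \<beta> k)"
  for a :: "'n::finite \<Rightarrow> complex"
proof -
  have "a k ^ qstep i \<beta> k = (if k = i then a k else 1) * a k ^ \<beta> k" for k
    by (simp add: qstep_def)
  then show ?thesis by (simp add: prod.distrib)
qed

lemma path_snoc:
  assumes "p \<noteq> []"
  shows "p @ [\<beta>] \<in> paths \<gamma> \<longleftrightarrow> \<gamma> = \<beta> \<and> (\<exists>i \<alpha>. \<beta> = qstep i \<alpha> \<and> p \<in> paths \<alpha>)"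
  using assms by (auto simp: paths_def successively_append_iff)

lemma paths_0: "paths (\<lambda>_. 0) = {[\<lambda>_. 0]}"
proof -
  have "p = [\<lambda>_. 0]" if "p \<in> paths (\<lambda>_. 0)" for p :: "('n \<Rightarrow> nat) list"
  proof (cases p rule: rev_cases)
    case Nil
    with that show ?thesis by (simp add: paths_def)
  next
    case (snoc q \<beta>)
    have "q = []"
      using that path_snoc[of q \<beta> "\<lambda>_. 0"] qstep_neq_0 unfolding snoc by metis
    with that snoc show ?thesis by (simp add: paths_def)
  qed
  moreover have "[\<lambda>_. 0] \<in> paths (\<lambda>_. 0)" by (simp add: paths_def)
  ultimately show ?thesis by blast
qed

text \<open>Split off the last vertex. The assumption excludes the one-vertex path, so a shorter
  path ending at a predecessor remains.\<close>

lemma paths_eq: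
  assumes "\<beta> \<noteq> (\<lambda>_. 0)"
  shows "paths \<beta> = (\<Union>i\<in>{i. \<beta> i \<noteq> 0}. (\<lambda>p. p @ [\<beta>]) ` paths (\<beta>(i := \<beta> i - 1)))"
proof (intro equalityI subsetI)
  fix p assume p: "p \<in> paths \<beta>"
  show "p \<in> (\<Union>i\<in>{i. \<beta> i \<noteq> 0}. (\<lambda>p. p @ [\<beta>]) ` paths (\<beta>(i := \<beta> i - 1)))"
  proof (cases p rule: rev_cases)
    case Nil
    with p show ?thesis by (simp add: paths_def)
  next
    case (snoc q \<gamma>)
    then have "q \<noteq> []" using p assms by (auto simp: paths_def)
    then obtain i \<alpha> where "\<gamma> = \<beta>" "\<beta> = qstep i \<alpha>" "q \<in> paths \<alpha>"
      using p path_snoc unfolding snoc by metis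
    then show ?thesis by (intro UN_I[of i]) (auto simp: snoc qstep_def)
  qed
next
  fix p assume "p \<in> (\<Union>i\<in>{i. \<beta> i \<noteq> 0}. (\<lambda>p. p @ [\<beta>]) ` paths (\<beta>(i := \<beta> i - 1)))"
  then obtain i q where i: "\<beta> i \<noteq> 0" and q: "q \<in> paths (\<beta>(i := \<beta> i - 1))" and p: "p = q @ [\<beta>]"
    by blast
  have "\<beta> = qstep i (\<beta>(i := \<beta> i - 1))" using i by (simp add: qstep_def)
  moreover have "q \<noteq> []" using q by (simp add: paths_def)
  ultimately show "p \<in> paths \<beta>" using q path_snoc unfolding p by blast
qed

text \<open>Every predecessor has coordinate sum smaller by one and there are finitely many of them.
  Finiteness gives \<open>path_partition\<close> its meaning as a sum.\<close>

lemma finite_paths: "finite (paths \<beta>)" for \<beta> :: "'n::finite \<Rightarrow> nat"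
proof (induction \<beta> rule: measure_induct_rule[of "\<lambda>\<beta>. \<Sum>i\<in>UNIV. \<beta> i"])
  case (less \<beta>)
  have "finite (paths (\<beta>(i := \<beta> i - 1)))" if "\<beta> i \<noteq> 0" for i
  proof (rule less)
    have "\<beta> = qstep i (\<beta>(i := \<beta> i - 1))" using that by (simp add: qstep_def)
    then show "sum (\<beta>(i := \<beta> i - 1)) UNIV < sum \<beta> UNIV" by (metis lessI sum_qstep)
  qed
  then show ?case
    by (cases "\<beta> = (\<lambda>_. 0)") (simp_all add: paths_0 paths_eq)
qed

text \<open>The start vertex, index 0, is left out of the product. As \<open>p\<close> is nonempty,
  the new vertex has positive index and does contribute.\<close>

lemma path_weight_snoc:
  assumes "p \<noteq> []"
  shows "path_weight G lam (p @ [\<beta>]) = path_weight G lam p / vertex_weight G lam \<beta>"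
proof -
  have "path_weight G lam (p @ [\<beta>]) = (\<Prod>k=1..<Suc (length p). 1 / vertex_weight G lam ((p @ [\<beta>]) ! k))"
    by (simp add: path_weight_def)
  also have "\<dots> = (\<Prod>k=1..<length p. 1 / vertex_weight G lam ((p @ [\<beta>]) ! k)) / vertex_weight G lam \<beta>"
    using assms by (subst prod.atLeastLessThan_Suc) (auto simp: Suc_le_eq)
  also have "(\<Prod>k=1..<length p. 1 / vertex_weight G lam ((p @ [\<beta>]) ! k)) = path_weight G lam p"
    unfolding path_weight_def by (intro prod.cong) (auto simp: nth_append)
  finally show ?thesis .
qed

lemma path_partition_0: "path_partition G lam (\<lambda>_. 0) = 1"
  by (simp add: path_partition_def paths_0 path_weight_def)

text \<open>Sort the paths by their last step; the factor of the endpoint is common to all of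
  them.\<close>

lemma path_partition_recursion:
  assumes "\<beta> \<noteq> (\<lambda>_. 0)"
  shows "path_partition G lam \<beta> =
    (\<Sum>i\<in>UNIV. lower i (path_partition G lam) \<beta>) / vertex_weight G lam \<beta>"
proof -
  let ?\<beta> = "\<lambda>i. \<beta>(i := \<beta> i - 1)"
  \<comment> \<open>The penultimate vertex tells the classes apart, since the predecessors differ in
    coordinate \<open>i\<close>.\<close>
  have disjoint: "(\<lambda>p. p @ [\<beta>]) ` paths (?\<beta> i) \<inter> (\<lambda>p. p @ [\<beta>]) ` paths (?\<beta> j) = {}"
    if "\<beta> i \<noteq> 0" "i \<noteq> j" for i j
  proof -
    have "?\<beta> i i \<noteq> ?\<beta> j i" using that by simp
    then have "?\<beta> i \<noteq> ?\<beta> j" by metis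
    then show ?thesis by (auto simp: paths_def)
  qed
  have "path_partition G lam \<beta> =
      (\<Sum>i\<in>{i. \<beta> i \<noteq> 0}. \<Sum>p\<in>(\<lambda>p. p @ [\<beta>]) ` paths (?\<beta> i). path_weight G lam p)"
    unfolding path_partition_def paths_eq[OF assms]
  proof (rule sum.UNION_disjoint)
    show "\<forall>i\<in>{i. \<beta> i \<noteq> 0}. finite ((\<lambda>p. p @ [\<beta>]) ` paths (?\<beta> i))"
      by (simp add: finite_paths)
    show "\<forall>i\<in>{i. \<beta> i \<noteq> 0}. \<forall>j\<in>{i. \<beta> i \<noteq> 0}. i \<noteq> j \<longrightarrow>
        (\<lambda>p. p @ [\<beta>]) ` paths (?\<beta> i) \<inter> (\<lambda>p. p @ [\<beta>]) ` paths (?\<beta> j) = {}"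
      using disjoint by blast
  qed simp
  also have "\<dots> = (\<Sum>i\<in>{i. \<beta> i \<noteq> 0}. path_partition G lam (?\<beta> i) / vertex_weight G lam \<beta>)"
  proof (rule sum.cong[OF HOL.refl])
    fix i
    have "(\<Sum>p\<in>(\<lambda>p. p @ [\<beta>]) ` paths (?\<beta> i). path_weight G lam p) =
        (\<Sum>p\<in>paths (?\<beta> i). path_weight G lam (p @ [\<beta>]))"
      by (subst sum.reindex) (auto simp: inj_on_def)
    also have "\<dots> = (\<Sum>p\<in>paths (?\<beta> i). path_weight G lam p / vertex_weight G lam \<beta>)"
      by (intro sum.cong HOL.refl path_weight_snoc) (auto simp: paths_def)
    finally show "(\<Sum>p\<in>(\<lambda>p. p @ [\<beta>]) ` paths (?\<beta> i). path_weight G lam p) =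
        path_partition G lam (?\<beta> i) / vertex_weight G lam \<beta>"
      by (simp add: path_partition_def sum_divide_distrib)
  qed
  \<comment> \<open>Missing predecessors contribute the default value 0 of
    \<open>lower\<close>.\<close>
  also have "\<dots> = (\<Sum>i\<in>UNIV. lower i (path_partition G lam) \<beta> / vertex_weight G lam \<beta>)"
    by (rule sum.mono_neutral_cong_left) (auto simp: lower_def)
  finally show ?thesis by (simp add: sum_divide_distrib)
qed

section \<open>The enveloping algebra\<close>

lemma uea_const_0 [simp]: "uea_const 0 = 0"
  by transfer (simp add: free_const_def uea_eq.refl)

lemma uea_const_1 [simp]: "uea_const 1 = 1"
  by transfer (simp add: free_const_def uea_eq.refl)

lemma uea_const_add: "uea_const (a + b) = uea_const a + uea_const b"
  by transfer (simp add: free_const_def single_add uea_eq.refl)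

lemma uea_const_mult: "uea_const (a * b) = uea_const a * uea_const b"
  by transfer (simp add: free_const_def mult_single uea_eq.refl)

lemma uea_const_diff: "uea_const (a - b) = uea_const a - uea_const b"
  by transfer (simp add: free_const_def single_diff uea_eq.refl)

text \<open>A finitely supported map arises by inserting one fresh key at a time, and each insertion
  is the addition of a monomial.\<close>

lemma poly_mapping_single_add_induct [case_names single add]:
  fixes p :: "'a \<Rightarrow>\<^sub>0 'b::comm_monoid_add"
  assumes single: "\<And>k v. P (Poly_Mapping.single k v)"
    and add: "\<And>p q. P p \<Longrightarrow> P q \<Longrightarrow> P (p + q)"
  shows "P p"
proof (induction p rule: Poly_Mapping.update_induct)
  case const
  \<comment> \<open>The zero map is the monomial with coefficient 0 at an arbitrary key.\<close>
  show ?case using single[of undefined 0] by simp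
next
  case (update f a b)
  have "Poly_Mapping.update a b f = f + Poly_Mapping.single a b"
    using update(1) by (intro poly_mapping_eqI)
      (auto simp: lookup_update lookup_add lookup_single in_keys_iff when_def)
  then show ?case using add[OF update(3) single] by simp
qed

text \<open>Constants are supported on the empty word, the unit of the word monoid, and the
  coefficients commute.\<close>

lemma free_const_commute: "free_const c * p = p * free_const c"
proof (induction p rule: poly_mapping_single_add_induct)
  case (single k v)
  show ?case by (simp add: free_const_def mult_single mult.commute)
next
  case (add p q)
  then show ?case by (simp add: algebra_simps)
qed

lemma uea_const_commute: "u * uea_const c = uea_const c * u"
  by transfer (simp add: free_const_commute uea_eq.refl)

lemma uea_const_left_commute: "u * (uea_const c * v) = uea_const c * (u * v)"
  by (metis mult.assoc uea_const_commute)

lemma uea_gen_add: "uea_gen (x + y) = uea_gen x + uea_gen y"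
  by transfer (rule uea_eq.gen_add)

lemma uea_gen_scaleC: "uea_gen (scaleC k x) = uea_const k * uea_gen x"
  by transfer (rule uea_eq.gen_scale)

lemma uea_gen_lie: "uea_gen (lie x y) = uea_gen x * uea_gen y - uea_gen y * uea_gen x"
  by transfer (rule uea_eq.gen_lie)

lemma uea_gen_0 [simp]: "uea_gen 0 = 0"
  using uea_gen_add[of 0 0] by simp

lemma uea_gen_minus: "uea_gen (- x) = - uea_gen x"
  using uea_gen_add[of x "- x"] by (simp add: eq_neg_iff_add_eq_0 add.commute)

text \<open>Words in the generators span the algebra. They grow on the left, which fits the left
  action on the Verma module.\<close>

lemma uea_induct [case_names const add gen]:
  fixes u :: "'g::complex_lie_algebra uea"
  assumes const: "\<And>c. P (uea_const c)"
    and add: "\<And>a b. P a \<Longrightarrow> P b \<Longrightarrow> P (a + b)"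
    and gen: "\<And>x u. P u \<Longrightarrow> P (uea_gen x * u)"
  shows "P u"
proof -
  \<comment> \<open>The predicate is pulled back to the free algebra, where an induction on the
    length of words is available.\<close>
  define Q where "Q a = P (abs_uea a)" for a :: "'g free_alg"
  have Qc: "Q (free_const c)" for c
    using const[of c] by (simp add: Q_def uea_const.abs_eq)
  have Qa: "Q a \<Longrightarrow> Q b \<Longrightarrow> Q (a + b)" for a b
    using add by (simp add: Q_def plus_uea.abs_eq[symmetric])
  have Qg: "Q a \<Longrightarrow> Q (free_gen x * a)" for a x
    using gen by (simp add: Q_def times_uea.abs_eq[symmetric] uea_gen.abs_eq)
  have single: "Q (Poly_Mapping.single (Free_Word xs) v)" for xs v
  proof (induction xs)
    case Nil
    then show ?case using Qc[of v] by (simp add: free_const_def zero_free_word_def)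
  next
    case (Cons x xs)
    from Qg[OF this, of x] show ?case
      by (simp add: free_gen_def mult_single plus_free_word_def)
  qed
  have "Q a" for a
  proof (induction a rule: poly_mapping_single_add_induct)
    case (single k v)
    then show ?case using \<open>\<And>xs v. Q (Poly_Mapping.single (Free_Word xs) v)\<close>[of "letters k" v] by simp
  next
    case (add p q)
    then show ?case by (simp add: Qa)
  qed
  then show ?thesis
    by (metis Q_def Quotient_uea Quotient_abs_rep)
qed

text \<open>Scalars act through the central constants, which opens spans and subspaces of the
  enveloping algebra to the linear algebra theory.\<close>

interpretation uea: vector_space "\<lambda>c u. uea_const c * (u :: 'g::complex_lie_algebra uea)"
  by unfold_locales (simp_all add: algebra_simps uea_const_add uea_const_mult mult.assoc)

lemma uea_subspaceI:
  assumes "0 \<in> S" "\<And>a b. a \<in> S \<Longrightarrow> b \<in> S \<Longrightarrow> a + b \<in> S" "\<And>u a. a \<in> S \<Longrightarrow> uea_const u * a \<in> S"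
  shows "uea.subspace S"
  using assms by (simp add: uea.subspace_def)

lemma left_ideal_subspace: "left_ideal I \<Longrightarrow> uea.subspace I"
  by (simp add: left_ideal_def uea.subspace_def)

lemma right_ideal_subspace: "right_ideal I \<Longrightarrow> uea.subspace I"
  unfolding right_ideal_def uea.subspace_def by (metis uea_const_commute)

lemma left_ideal_hull: "left_ideal (left_ideal hull S)"
  by (rule hull_in) (auto simp: left_ideal_def)

lemma right_ideal_hull: "right_ideal (right_ideal hull S)"
  by (rule hull_in) (auto simp: right_ideal_def)

section \<open>Identities for the Lie bracket\<close>

lemma lie_0_right [simp]: "lie x 0 = (0 :: 'g::complex_lie_algebra)"
  using lie_add_right[of x 0 0] by simp

lemma lie_0_left [simp]: "lie 0 x = (0 :: 'g::complex_lie_algebra)"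
  using lie_add_left[of 0 0 x] by simp

lemma lie_antisym: "lie y x = - lie x (y :: 'g::complex_lie_algebra)"
proof -
  have "lie y x + lie x y = 0"
    using lie_self[of "x + y", unfolded lie_add_left lie_add_right] by (simp add: lie_self add.commute)
  then show ?thesis by (simp only: eq_neg_iff_add_eq_0)
qed

lemma lie_minus_right: "lie x (- y) = - lie x (y :: 'g::complex_lie_algebra)"
  using lie_add_right[of x y "- y"] by (simp add: eq_neg_iff_add_eq_0 add.commute)

text \<open>The Jacobi identity read as: bracketing with \<open>z\<close> is a derivation. Hence the
  centralizer of \<open>z\<close> is a subalgebra.\<close>

lemma lie_leibniz: "lie z (lie x y) = lie (lie z x) y + lie x (lie z (y :: 'g::complex_lie_algebra))"
  using jacobi[of z x y] lie_antisym[of "lie z x" y] lie_antisym[of y z]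
  by (simp add: lie_minus_right algebra_simps)

section \<open>Roots and the invariant form\<close>

locale chevalley =
  fixes G :: "('g::complex_lie_algebra, 'n::finite) chevalley"
  assumes chevalley_data: "chevalley_data G"
begin

lemma
  shows simple: "simple_lie TYPE('g)"
    and inj_hh: "inj (hh G)"
    and independent_hh: "clie.independent (range (hh G))"
    and lie_hh_hh: "lie (hh G i) (hh G j) = 0"
    and lie_hh_ee: "lie (hh G i) (ee G j) = scaleC (of_int (cartan G j i)) (ee G j)"
    and lie_hh_ff: "lie (hh G i) (ff G j) = - scaleC (of_int (cartan G j i)) (ff G j)"
    and lie_ee_ff: "lie (ee G i) (ff G j) = (if i = j then hh G j else 0)"
    and cartan_diag: "cartan G i i = 2"
    and dd_pos: "dd G i > 0"
    and cartan_symmetrizable: "cartan G i j * int (dd G j) = cartan G j i * int (dd G i)"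
  using chevalley_data unfolding chevalley_data_def by auto

lemma triangular:
  obtains a h b where "a \<in> nminus G" "h \<in> hsub G" "b \<in> nplus G" "x = a + h + b"
proof -
  have "\<forall>x. \<exists>!t. t \<in> nminus G \<times> hsub G \<times> nplus G \<and> x = fst t + fst (snd t) + snd (snd t)"
    using chevalley_data unfolding chevalley_data_def by (elim conjE)
  then obtain t where "t \<in> nminus G \<times> hsub G \<times> nplus G" "x = fst t + fst (snd t) + snd (snd t)"
    by blast
  then show ?thesis using that[of "fst t" "fst (snd t)" "snd (snd t)"] by (auto simp: mem_Times_iff)
qed

text \<open>By the triangular decomposition the Chevalley generators generate the Lie algebra. A
  property that cuts out a subalgebra therefore has to be checked only on e_i, f_i and h_i.\<close>

lemma subalgebra_eq_UNIV:
  assumes "lie_subalgebra T" "range (ee G) \<subseteq> T" "range (ff G) \<subseteq> T" "range (hh G) \<subseteq> T"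
  shows "T = UNIV"
proof -
  have sub: "clie.subspace T" using assms(1) by (simp add: lie_subalgebra_def)
  have "nminus G \<subseteq> T" "nplus G \<subseteq> T"
    unfolding nminus_def nplus_def by (simp_all add: hull_minimal assms)
  moreover have "hsub G \<subseteq> T"
    unfolding hsub_def using assms(4) sub by (rule clie.span_minimal)
  ultimately have "x \<in> T" for x
    by (rule_tac x = x in triangular) (auto intro!: clie.subspace_add[OF sub])
  then show ?thesis by blast
qed

text \<open>The centre is an ideal, and it is proper because some bracket is nonzero.\<close>

lemma central_eq_0:
  assumes "\<And>x :: 'g. lie z x = 0"
  shows "z = 0"
proof -
  let ?Z = "{z :: 'g. \<forall>x. lie z x = 0}"
  have "lie x z = 0" if "\<forall>x. lie z x = 0" for x z :: 'g
    using lie_antisym[of x z] that by simp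
  then have "lie_ideal ?Z"
    unfolding lie_ideal_def clie.subspace_def by (simp add: lie_add_left lie_scaleC_left)
  moreover have "?Z \<noteq> UNIV" using simple unfolding simple_lie_def by blast
  ultimately have "?Z = {0}" using simple unfolding simple_lie_def by blast
  with assms show ?thesis by blast
qed

text \<open>A kernel vector of the Cartan matrix gives a central element of the Cartan subalgebra,
  and the centre of a simple Lie algebra is zero.\<close>

lemma cartan_kernel_trivial:
  fixes c :: "'n \<Rightarrow> complex"
  assumes c: "\<And>j. (\<Sum>i\<in>UNIV. of_int (cartan G j i) * c i) = 0"
  shows "c i = 0"
proof -
  \<comment> \<open>The scalar by which \<open>z\<close> acts on \<open>ee G j\<close> is
    \<alpha>_j(z), the j-th entry of the Cartan matrix applied to \<open>c\<close>.\<close>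
  define z where "z = (\<Sum>i\<in>UNIV. scaleC (c i) (hh G i))"
  have lie_sum: "lie (\<Sum>i\<in>A. f i) y = (\<Sum>i\<in>A. lie (f i) y)" for f :: "'n \<Rightarrow> 'g" and y A
    by (induction A rule: infinite_finite_induct) (auto simp: lie_add_left)
  let ?T = "{y. lie z y = 0}"
  have "lie z (ee G j) = scaleC (\<Sum>i\<in>UNIV. of_int (cartan G j i) * c i) (ee G j)" for j
    by (simp add: z_def lie_sum lie_scaleC_left lie_hh_ee scaleC_scaleC clie.scale_sum_left mult.commute)
  then have e: "lie z (ee G j) = 0" for j by (simp add: c)
  have "lie z (ff G j) = - scaleC (\<Sum>i\<in>UNIV. of_int (cartan G j i) * c i) (ff G j)" for j
    by (simp add: z_def lie_sum lie_scaleC_left lie_hh_ff scaleC_scaleC clie.scale_sum_left mult.commute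
        clie.scale_minus_right sum_negf)
  then have f: "lie z (ff G j) = 0" for j by (simp add: c)
  have h: "lie z (hh G j) = 0" for j
    by (simp add: z_def lie_sum lie_scaleC_left lie_hh_hh)
  have "lie z (lie x y) = 0" if "lie z x = 0" "lie z y = 0" for x y
    using that lie_leibniz[of z x y] by simp
  then have "lie_subalgebra ?T"
    unfolding lie_subalgebra_def clie.subspace_def
    by (simp add: lie_add_right lie_scaleC_right)
  then have "?T = UNIV" by (rule subalgebra_eq_UNIV) (auto simp: e f h)
  then have "lie z x = 0" for x by blast
  then have "z = 0" by (rule central_eq_0)
  \<comment> \<open>Independence is stated for a set of vectors, so the coefficients are reindexed
    along the injective \<open>hh G\<close>.\<close>
  then have "(\<Sum>v\<in>range (hh G). scaleC (c (inv (hh G) v)) v) = 0"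
    by (simp add: z_def sum.reindex[OF inj_hh] inv_f_f[OF inj_hh])
  then have "c (inv (hh G) v) = 0" if "v \<in> range (hh G)" for v
    using clie.independentD[OF independent_hh finite_imageI[OF finite] subset_refl, of "\<lambda>v. c (inv (hh G) v)"] that
    by auto
  from this[of "hh G i"] show ?thesis by (simp add: inv_f_f[OF inj_hh])
qed

text \<open>The columns are the simple roots in the coordinates of weights, so multiplication turns
  root coordinates into weight coordinates.\<close>

definition root_matrix :: "complex^'n^'n" where
  "root_matrix = transpose (\<chi> i j. of_int (cartan G i j))"

lemma root_matrix_mult: "root_matrix *v a = (\<Sum>i\<in>UNIV. a $ i *s simple_root G i)"
  by (simp add: vec_eq_iff root_matrix_def matrix_vector_mult_def transpose_def simple_root_def mult.commute)

text \<open>The Cartan matrix itself has trivial kernel, and transposition preserves the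
  determinant.\<close>

lemma invertible_root_matrix: "invertible root_matrix"
proof -
  let ?A = "(\<chi> i j. of_int (cartan G i j)) :: complex^'n^'n"
  have "x = 0" if "?A *v x = 0" for x
    using that cartan_kernel_trivial[of "\<lambda>i. x $ i"]
    by (simp add: vec_eq_iff matrix_vector_mult_def)
  then have "inj ((*v) ?A)"
    by (metis (no_types, lifting) injI eq_iff_diff_eq_0 matrix_vector_mult_diff_distrib)
  then have "invertible ?A"
    by (simp add: invertible_left_inverse matrix_left_invertible_injective)
  then show ?thesis
    by (simp add: root_matrix_def invertible_det_nz)
qed

lemma simple_root_expansion:
  obtains a :: "complex^'n" where "x = (\<Sum>i\<in>UNIV. a $ i *s simple_root G i)"
proof -
  have "surj ((*v) root_matrix)"
    using invertible_root_matrix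
    by (simp add: invertible_right_inverse matrix_right_invertible_surjective)
  then obtain a where "x = root_matrix *v a" by (rule surjE)
  then show ?thesis using that by (simp add: root_matrix_mult)
qed

lemma simple_root_expansion_unique:
  assumes "(\<Sum>i\<in>UNIV. a $ i *s simple_root G i) = (\<Sum>i\<in>UNIV. b $ i *s simple_root G i)"
  shows "a = b"
proof -
  have "inj ((*v) root_matrix)"
    using invertible_root_matrix by (simp add: invertible_left_inverse matrix_left_invertible_injective)
  then show ?thesis using assms unfolding root_matrix_mult[symmetric] by (rule injD)
qed

lemma qwt_eq: "qwt G \<beta> = (\<Sum>i\<in>UNIV. (\<chi> i. of_nat (\<beta> i)) $ i *s simple_root G i)"
  by (simp add: qwt_def)

text \<open>Linear independence of the simple roots over the complex numbers, restricted to natural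
  coefficients. It makes the weights \<lambda> - \<beta> pairwise distinct.\<close>

lemma inj_qwt: "inj (qwt G)"
proof
  fix \<beta> \<gamma> assume "qwt G \<beta> = qwt G \<gamma>"
  then have "(\<chi> i. of_nat (\<beta> i)) = ((\<chi> i. of_nat (\<gamma> i)) :: complex^'n)"
    unfolding qwt_eq by (rule simple_root_expansion_unique)
  then show "\<beta> = \<gamma>" by (auto simp: vec_eq_iff)
qed

lemma qwt_0 [simp]: "qwt G (\<lambda>_. 0) = 0"
  by (simp add: qwt_def)

lemma qwt_qstep: "qwt G (qstep i \<beta>) = qwt G \<beta> + simple_root G i"
proof -
  have "of_nat (qstep i \<beta> k) *s simple_root G k =
      of_nat (\<beta> k) *s simple_root G k + (if k = i then simple_root G k else 0)" for k
    by (auto simp: qstep_def vec_eq_iff algebra_simps)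
  then show ?thesis by (simp add: qwt_def sum.distrib)
qed

text \<open>Serves to show that e_j kills the components with \<open>\<beta> j = 0\<close>: the
  image would have a weight outside \<lambda> - Q_+.\<close>

lemma minus_simple_root_notin_qwt:
  assumes "\<beta> j = 0"
  shows "qwt G \<beta> - simple_root G j \<noteq> qwt G \<gamma>"
proof
  assume "qwt G \<beta> - simple_root G j = qwt G \<gamma>"
  then have "qwt G \<beta> = qwt G (qstep j \<gamma>)" by (simp add: qwt_qstep algebra_simps)
  then have "\<beta> = qstep j \<gamma>" using inj_qwt by (simp add: inj_eq)
  with assms show False by (simp add: qstep_def)
qed

section \<open>The symmetric form on weights\<close>

lemma weight_form_simple_root:
  assumes B: "is_weight_form G B"
  shows "B x (simple_root G j) = of_nat (dd G j) * x $ j"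
proof -
  have lin: "Vector_Spaces.linear (*s) (*) (B y)" and sym: "B y z = B z y"
    and val: "B (simple_root G i) (coroot G j) = of_int (cartan G i j)" for y z i j
    using B by (auto simp: is_weight_form_def)
  interpret l: Vector_Spaces.linear "(*s)" "(*)" "B y" for y by (rule lin)
  have root: "B (simple_root G i) (simple_root G j) = of_nat (dd G j) * of_int (cartan G i j)" for i
  proof -
    have "simple_root G j = of_nat (dd G j) *s coroot G j"
      using dd_pos[of j] by (simp add: coroot_def)
    then show ?thesis by (metis l.scale val)
  qed
  \<comment> \<open>Expanding \<open>x\<close> in simple roots reduces the claim to the values on
    pairs of simple roots, which the normalization prescribes.\<close>
  obtain a where a: "x = (\<Sum>i\<in>UNIV. a $ i *s simple_root G i)" by (rule simple_root_expansion)
  have "B x (simple_root G j) = B (simple_root G j) x" by (rule sym)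
  also have "\<dots> = (\<Sum>i\<in>UNIV. a $ i * B (simple_root G j) (simple_root G i))"
    by (simp add: a l.sum l.scale)
  also have "\<dots> = (\<Sum>i\<in>UNIV. a $ i * (of_nat (dd G j) * of_int (cartan G i j)))"
    by (simp add: sym[of "simple_root G j"] root)
  also have "\<dots> = of_nat (dd G j) * x $ j"
    by (simp add: a simple_root_def sum_distrib_left algebra_simps)
  finally show ?thesis .
qed

lemma weight_form_unique:
  assumes "is_weight_form G B" "is_weight_form G B'"
  shows "B = B'"
proof (intro ext)
  fix x y
  obtain b where b: "y = (\<Sum>i\<in>UNIV. b $ i *s simple_root G i)" by (rule simple_root_expansion)
  have expand: "D x y = (\<Sum>i\<in>UNIV. b $ i * (of_nat (dd G i) * x $ i))" if D: "is_weight_form G D" for D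
  proof -
    interpret l: Vector_Spaces.linear "(*s)" "(*)" "D x" using D by (simp add: is_weight_form_def)
    show ?thesis by (simp add: b l.sum l.scale weight_form_simple_root[OF D])
  qed
  show "B x y = B' x y" by (simp add: expand assms)
qed

text \<open>The formula forced by \<open>weight_form_simple_root\<close> is taken as the definition;
  its symmetry is the symmetrizability of the Cartan matrix.\<close>

lemma weight_form_exists: "\<exists>B. is_weight_form G B"
proof -
  obtain inv where inv: "root_matrix ** inv = mat 1" "inv ** root_matrix = mat 1"
    using invertible_root_matrix unfolding invertible_def by blast
  \<comment> \<open>\<open>inv *v x\<close> consists of the coordinates of \<open>x\<close> with
    respect to the simple roots.\<close>
  define B where "B x y = (\<Sum>i\<in>UNIV. (inv *v x) $ i * of_nat (dd G i) * y $ i)" for x y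
  have expand: "x $ i = (\<Sum>j\<in>UNIV. (inv *v x) $ j * of_int (cartan G j i))" for x i
  proof -
    have "x = root_matrix *v (inv *v x)" by (simp add: matrix_vector_mul_assoc inv)
    also have "\<dots> $ i = (\<Sum>j\<in>UNIV. (inv *v x) $ j * of_int (cartan G j i))"
      by (simp add: root_matrix_mult simple_root_def)
    finally show ?thesis .
  qed
  have d: "of_nat (dd G i) * of_int (cartan G j i) = (of_nat (dd G j) * of_int (cartan G i j) :: complex)" for i j
    using arg_cong[OF cartan_symmetrizable[of i j], of "of_int :: int \<Rightarrow> complex"] by (simp add: mult.commute)
  have B: "B x y = (\<Sum>i\<in>UNIV. \<Sum>j\<in>UNIV. (inv *v x) $ i * (inv *v y) $ j * (of_nat (dd G i) * of_int (cartan G j i)))" for x y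
    unfolding B_def by (subst expand[of y]) (simp add: sum_distrib_left algebra_simps)
  have sym: "B x y = B y x" for x y
    unfolding B by (subst sum.swap, subst d) (simp add: mult.commute mult.left_commute)
  have root: "inv *v simple_root G i = axis i 1" for i
  proof -
    have "simple_root G i = root_matrix *v axis i 1"
      by (simp add: root_matrix_mult axis_def if_distrib[of "\<lambda>c. c *s _"] cong: if_cong)
    then show ?thesis by (simp add: matrix_vector_mul_assoc inv)
  qed
  have "B (simple_root G i) (coroot G j) = of_int (cartan G i j)" for i j
  proof -
    have "B (simple_root G i) (coroot G j) = of_nat (dd G i) * coroot G j $ i"
      by (simp add: B_def root axis_def if_distrib[of "\<lambda>c. c * _"] cong: if_cong)
    also have "\<dots> = (of_nat (dd G i) * of_int (cartan G j i)) / of_nat (dd G j)"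
      by (simp add: coroot_def simple_root_def)
    also have "\<dots> = of_int (cartan G i j)"
      using dd_pos[of j] by (subst d) simp
    finally show ?thesis .
  qed
  moreover have "Vector_Spaces.linear (*s) (*) (B x)" for x
    unfolding B_def by unfold_locales (simp_all add: algebra_simps sum.distrib sum_distrib_left)
  ultimately have "is_weight_form G B" using sym by (simp add: is_weight_form_def)
  then show ?thesis by blast
qed

lemma is_weight_form_wform: "is_weight_form G (wform G)"
  unfolding wform_def using weight_form_exists weight_form_unique by (metis theI)

lemma wform_simple_root: "wform G x (simple_root G j) = of_nat (dd G j) * x $ j"
  by (rule weight_form_simple_root[OF is_weight_form_wform])

lemma wform_commute: "wform G x y = wform G y x"
  using is_weight_form_wform by (simp add: is_weight_form_def)

lemma wform_linear: "Vector_Spaces.linear (*s) (*) (wform G x)"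
  using is_weight_form_wform by (simp add: is_weight_form_def)

lemma wform_add_right: "wform G x (y + z) = wform G x y + wform G x z"
proof -
  interpret l: Vector_Spaces.linear "(*s)" "(*)" "wform G x" by (rule wform_linear)
  show ?thesis by (rule l.add)
qed

lemma wform_add_left: "wform G (x + y) z = wform G x z + wform G y z"
  by (simp add: wform_commute[of _ z] wform_add_right)

lemma wform_scale_right: "wform G x (c *s y) = c * wform G x y"
proof -
  interpret l: Vector_Spaces.linear "(*s)" "(*)" "wform G x" by (rule wform_linear)
  show ?thesis by (rule l.scale)
qed

text \<open>Pairing with a co-root evaluates the weight on h_i, so the exponents on both sides of
  the theorem are the same linear forms.\<close>

lemma wform_phi_eq: "wform_phi G \<nu> = \<nu>"
proof -
  have "wform G \<nu> (coroot G i) = \<nu> $ i" for i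
    using dd_pos[of i] by (simp add: coroot_def wform_scale_right wform_simple_root)
  then show ?thesis by (simp add: wform_phi_def)
qed

lemma vertex_weight_0: "vertex_weight G lam (\<lambda>_. 0) = 0"
  using wform_scale_right[of _ 0 0] by (simp add: vertex_weight_def)

text \<open>The contributions of (\<rho>|\<alpha>_i) and of half of (\<alpha>_i|\<alpha>_i) both
  equal d_i and cancel.\<close>

lemma vertex_weight_qstep:
  "vertex_weight G lam (qstep i \<beta>) = vertex_weight G lam \<beta> + of_nat (dd G i) * (lam - qwt G \<beta>) $ i"
proof -
  have "rho $ i = 1" by (simp add: rho_def fund_weight_def axis_def)
  moreover have "simple_root G i $ i = 2" by (simp add: simple_root_def cartan_diag)
  moreover have "wform G (simple_root G i) (qwt G \<beta>) = of_nat (dd G i) * qwt G \<beta> $ i"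
    by (simp add: wform_commute[of "simple_root G i"] wform_simple_root)
  ultimately show ?thesis
    by (simp add: vertex_weight_def qwt_qstep wform_add_left wform_add_right wform_simple_root field_simps)
qed

section \<open>Commutation relations of the Chevalley generators\<close>

abbreviation "E i \<equiv> uea_gen (ee G i)"
abbreviation "F i \<equiv> uea_gen (ff G i)"
abbreviation "H i \<equiv> uea_gen (hh G i)"

lemma E_F: "E i * F j = F j * E i + (if i = j then H j else 0)"
  using uea_gen_lie[of "ee G i" "ff G j"] by (auto simp: lie_ee_ff algebra_simps split: if_splits)

lemma H_F: "H k * F i = F i * H k - uea_const (simple_root G i $ k) * F i"
  using uea_gen_lie[of "hh G k" "ff G i"]
  by (simp add: lie_hh_ff uea_gen_minus uea_gen_scaleC simple_root_def algebra_simps)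

lemma H_E: "H k * E i = E i * H k + uea_const (simple_root G i $ k) * E i"
  using uea_gen_lie[of "hh G k" "ee G i"]
  by (simp add: lie_hh_ee uea_gen_scaleC simple_root_def algebra_simps)

end

section \<open>Weight spaces of the Verma module\<close>

lemma uea_span_mult:
  assumes "\<And>y. y \<in> B \<Longrightarrow> a * y \<in> uea.span C" and "z \<in> uea.span B"
  shows "a * z \<in> uea.span C"
proof -
  have "uea.subspace {z. a * z \<in> uea.span C}"
    by (rule uea_subspaceI)
      (auto simp: algebra_simps uea_const_left_commute[of a] uea.span_zero uea.span_add uea.span_scale)
  from uea.span_induct[OF assms(2) this] assms(1) show ?thesis by blast
qed

locale verma_module = chevalley G
  for G :: "('g::complex_lie_algebra, 'n::finite) chevalley" +
  fixes lam :: "'n weight"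
  assumes irreducible: "verma_irreducible G lam"
begin

section \<open>The two ideals, their cosets and the actions\<close>

abbreviation "I \<equiv> verma_ideal G lam"
abbreviation "J \<equiv> dual_verma_ideal G lam"

lemma left_ideal_I: "left_ideal I"
  unfolding verma_ideal_def by (rule left_ideal_hull)

lemma right_ideal_J: "right_ideal J"
  unfolding dual_verma_ideal_def by (rule right_ideal_hull)

lemma subspace_I: "uea.subspace I"
  by (rule left_ideal_subspace[OF left_ideal_I])

lemma subspace_J: "uea.subspace J"
  by (rule right_ideal_subspace[OF right_ideal_J])

lemmas I_add = uea.subspace_add[OF subspace_I]
  and I_diff = uea.subspace_diff[OF subspace_I]
  and I_0 = uea.subspace_0[OF subspace_I]
  and I_sum = uea.subspace_sum[OF subspace_I]
  and J_add = uea.subspace_add[OF subspace_J]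
  and J_diff = uea.subspace_diff[OF subspace_J]
  and J_0 = uea.subspace_0[OF subspace_J]

lemma I_mult: "a \<in> I \<Longrightarrow> u * a \<in> I"
  using left_ideal_I by (simp add: left_ideal_def)

lemma J_mult: "a \<in> J \<Longrightarrow> a * u \<in> J"
  using right_ideal_J by (simp add: right_ideal_def)

lemma mem_ket: "a \<in> ket G lam u \<longleftrightarrow> a - u \<in> I"
  by (simp add: ket_def)

lemma mem_bra: "a \<in> bra G lam u \<longleftrightarrow> a - u \<in> J"
  by (simp add: bra_def)

lemma ket_eq_iff: "ket G lam u = ket G lam v \<longleftrightarrow> u - v \<in> I"
proof
  assume "ket G lam u = ket G lam v"
  moreover have "u \<in> ket G lam u" by (simp add: ket_def I_0)
  ultimately show "u - v \<in> I" by (simp add: ket_def)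
next
  assume uv: "u - v \<in> I"
  have "a - u \<in> I \<longleftrightarrow> a - v \<in> I" for a
    using I_add[OF _ uv, of "a - u"] I_diff[OF _ uv, of "a - v"] by auto
  then show "ket G lam u = ket G lam v" by (simp add: ket_def)
qed

lemma bra_eq_iff: "bra G lam u = bra G lam v \<longleftrightarrow> u - v \<in> J"
proof
  assume "bra G lam u = bra G lam v"
  moreover have "u \<in> bra G lam u" by (simp add: bra_def J_0)
  ultimately show "u - v \<in> J" by (simp add: bra_def)
next
  assume uv: "u - v \<in> J"
  have "a - u \<in> J \<longleftrightarrow> a - v \<in> J" for a
    using J_add[OF _ uv, of "a - u"] J_diff[OF _ uv, of "a - v"] by auto
  then show "bra G lam u = bra G lam v" by (simp add: bra_def)
qed

text \<open>The union over representatives collapses to a single coset, because \<open>I\<close>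
  absorbs multiplication from the left.\<close>

lemma ket_act_ket: "ket_act G lam u (ket G lam a) = ket G lam (u * a)"
proof -
  have "ket G lam (u * b) = ket G lam (u * a)" if "b \<in> ket G lam a" for b
    using I_mult[of "b - a" u] that by (simp add: ket_eq_iff mem_ket right_diff_distrib)
  moreover have "a \<in> ket G lam a" by (simp add: mem_ket I_0)
  ultimately show ?thesis unfolding ket_act_def by blast
qed

lemma bra_act_bra: "bra_act G lam (bra G lam a) u = bra G lam (a * u)"
proof -
  have "bra G lam (b * u) = bra G lam (a * u)" if "b \<in> bra G lam a" for b
    using J_mult[of "b - a" u] that by (simp add: bra_eq_iff mem_bra left_diff_distrib)
  moreover have "a \<in> bra G lam a" by (simp add: mem_bra J_0)
  ultimately show ?thesis unfolding bra_act_def by blast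
qed

lemma ket_add_ket: "ket_add G lam (ket G lam a) (ket G lam b) = ket G lam (a + b)"
proof -
  have "ket G lam (a' + b') = ket G lam (a + b)" if "a' \<in> ket G lam a" "b' \<in> ket G lam b" for a' b'
    using I_add[of "a' - a" "b' - b"] that by (simp add: ket_eq_iff mem_ket algebra_simps)
  moreover have "a \<in> ket G lam a" "b \<in> ket G lam b" by (simp_all add: mem_ket I_0)
  ultimately show ?thesis unfolding ket_add_def by blast
qed

text \<open>Otherwise the Verma module would be zero, which irreducibility excludes.\<close>

lemma one_notin_I: "1 \<notin> I"
proof
  assume "1 \<in> I"
  then have "u \<in> I" for u using I_mult[of 1 u] by simp
  then have "ket G lam u = ket G lam 0" for u by (simp add: ket_eq_iff)
  then have "verma G lam = {ket G lam 0}" unfolding verma_def by auto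
  then show False using irreducible by (simp add: verma_irreducible_def)
qed

lemma E_in_I: "E i \<in> I"
  unfolding verma_ideal_def nplus_def by (blast intro: hull_inc)

lemma H_in_I: "H i - uea_const (lam $ i) \<in> I"
  unfolding verma_ideal_def by (blast intro: hull_inc)

lemma F_in_J: "F i * u \<in> J"
  unfolding dual_verma_ideal_def nminus_def
  by (rule J_mult[unfolded dual_verma_ideal_def nminus_def]) (blast intro: hull_inc)

text \<open>The preimage in the enveloping algebra of the weight space of weight \<nu>. Every such
  preimage contains \<open>I\<close>.\<close>

definition Wt :: "'n weight \<Rightarrow> 'g uea set" where
  "Wt \<nu> = {u. \<forall>i. H i * u - uea_const (\<nu> $ i) * u \<in> I}"

lemma Wt_subspace: "uea.subspace (Wt \<nu>)"
proof (rule uea_subspaceI)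
  show "0 \<in> Wt \<nu>" by (simp add: Wt_def I_0)
next
  fix a b assume "a \<in> Wt \<nu>" "b \<in> Wt \<nu>"
  then have "H i * a - uea_const (\<nu> $ i) * a + (H i * b - uea_const (\<nu> $ i) * b) \<in> I" for i
    by (intro I_add) (simp_all add: Wt_def)
  then show "a + b \<in> Wt \<nu>" by (simp add: Wt_def algebra_simps)
next
  fix c a assume "a \<in> Wt \<nu>"
  then have "uea_const c * (H i * a - uea_const (\<nu> $ i) * a) \<in> I" for i
    by (intro I_mult) (simp add: Wt_def)
  moreover have "uea_const c * (H i * a - uea_const (\<nu> $ i) * a) =
      H i * (uea_const c * a) - uea_const (\<nu> $ i) * (uea_const c * a)" for i
    by (simp add: right_diff_distrib uea_const_left_commute[of "H i" c a]
        uea_const_left_commute[of "uea_const (\<nu> $ i)" c a])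
  ultimately show "uea_const c * a \<in> Wt \<nu>" by (simp add: Wt_def)
qed

lemma I_Wt: "a \<in> I \<Longrightarrow> a \<in> Wt \<nu>"
  by (simp add: Wt_def I_diff I_mult)

lemma one_Wt: "1 \<in> Wt lam"
  using H_in_I by (simp add: Wt_def)

lemma F_Wt:
  assumes "u \<in> Wt \<nu>"
  shows "F i * u \<in> Wt (\<nu> - simple_root G i)"
proof -
  have "F i * (H k * u - uea_const (\<nu> $ k) * u) \<in> I" for k
    using assms by (intro I_mult) (simp add: Wt_def)
  moreover have "H k * (F i * u) = F i * (H k * u) - uea_const (simple_root G i $ k) * (F i * u)" for k
    by (simp add: mult.assoc[symmetric] H_F left_diff_distrib)
  then have "F i * (H k * u - uea_const (\<nu> $ k) * u) =
      H k * (F i * u) - uea_const ((\<nu> - simple_root G i) $ k) * (F i * u)" for k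
    by (simp add: right_diff_distrib left_diff_distrib uea_const_left_commute[of "F i"] uea_const_diff)
  ultimately show ?thesis by (simp add: Wt_def)
qed

lemma E_Wt:
  assumes "u \<in> Wt \<nu>"
  shows "E i * u \<in> Wt (\<nu> + simple_root G i)"
proof -
  have "E i * (H k * u - uea_const (\<nu> $ k) * u) \<in> I" for k
    using assms by (intro I_mult) (simp add: Wt_def)
  moreover have "H k * (E i * u) = E i * (H k * u) + uea_const (simple_root G i $ k) * (E i * u)" for k
    by (simp add: mult.assoc[symmetric] H_E distrib_right)
  then have "E i * (H k * u - uea_const (\<nu> $ k) * u) =
      H k * (E i * u) - uea_const ((\<nu> + simple_root G i) $ k) * (E i * u)" for k
    by (simp add: right_diff_distrib distrib_right uea_const_left_commute[of "E i"] uea_const_add)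
  ultimately show ?thesis by (simp add: Wt_def)
qed

text \<open>Simultaneous eigenvectors for distinct weights are independent modulo \<open>I\<close>: apply
  \<open>H i - \<nu> i\<close> to remove one of them.\<close>

lemma Wt_independent:
  assumes "finite A" "\<And>\<nu>. \<nu> \<in> A \<Longrightarrow> u \<nu> \<in> Wt \<nu>" "(\<Sum>\<nu>\<in>A. u \<nu>) \<in> I" "\<nu> \<in> A"
  shows "u \<nu> \<in> I"
  using assms
proof (induction A arbitrary: u \<nu> rule: finite_induct)
  case empty
  then show ?case by simp
next
  case (insert \<nu>0 A)
  have A: "u \<nu> \<in> I" if "\<nu> \<in> A" for \<nu>
  proof -
    from that insert.hyps have "\<nu> \<noteq> \<nu>0" by blast
    then obtain i where i: "\<nu> $ i \<noteq> \<nu>0 $ i" by (auto simp: vec_eq_iff)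
    define D where "D = H i - uea_const (\<nu>0 $ i)"
    let ?c = "\<lambda>\<nu>. \<nu> $ i - \<nu>0 $ i"
    have split: "D * v - uea_const (?c \<nu>) * v = H i * v - uea_const (\<nu> $ i) * v" for v \<nu>
      using uea_const_add[of "?c \<nu>" "\<nu>0 $ i"] by (simp add: D_def algebra_simps)
    have D: "D * u \<nu> - uea_const (?c \<nu>) * u \<nu> \<in> I" if "\<nu> \<in> insert \<nu>0 A" for \<nu>
      using insert.prems(1)[OF that] unfolding split by (simp add: Wt_def)
    have "D * (\<Sum>\<nu>\<in>insert \<nu>0 A. u \<nu>) - (\<Sum>\<nu>\<in>insert \<nu>0 A. D * u \<nu> - uea_const (?c \<nu>) * u \<nu>) \<in> I"
      by (intro I_diff I_mult insert.prems I_sum D)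
    then have "(\<Sum>\<nu>\<in>A. uea_const (?c \<nu>) * u \<nu>) \<in> I"
      using insert.hyps by (simp add: sum_subtractf sum_distrib_left distrib_left)
    moreover have "uea_const (?c \<nu>) * u \<nu> \<in> Wt \<nu>" if "\<nu> \<in> A" for \<nu>
      using uea.subspace_scale[OF Wt_subspace] insert.prems(1) that by simp
    ultimately have "uea_const (?c \<nu>) * u \<nu> \<in> I" using that by (rule_tac insert.IH)
    then have "uea_const (1 / ?c \<nu>) * (uea_const (?c \<nu>) * u \<nu>) \<in> I" by (rule I_mult)
    then show ?thesis using i by (simp add: mult.assoc[symmetric] uea_const_mult[symmetric])
  qed
  have "(\<Sum>\<nu>\<in>insert \<nu>0 A. u \<nu>) - (\<Sum>\<nu>\<in>A. u \<nu>) \<in> I"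
    by (intro I_diff insert.prems I_sum A)
  then have "u \<nu>0 \<in> I" using insert.hyps by simp
  with A insert.prems(3) show ?case by blast
qed

text \<open>An expansion of \<open>y\<close> into other weights is a relation between vectors of
  distinct weights, so \<open>Wt_independent\<close> applies.\<close>

lemma Wt_span_disjoint:
  assumes y: "y \<in> Wt \<nu>" and \<nu>: "\<nu> \<notin> \<Gamma>" and span: "y \<in> uea.span (\<Union>\<nu>\<in>\<Gamma>. Wt \<nu>)"
  shows "y \<in> I"
proof -
  from span obtain t r where t: "finite t" "t \<subseteq> (\<Union>\<nu>\<in>\<Gamma>. Wt \<nu>)"
    and sum: "y = (\<Sum>a\<in>t. uea_const (r a) * a)"
    unfolding uea.span_explicit by blast
  from t(2) have "\<forall>a\<in>t. \<exists>\<nu>\<in>\<Gamma>. a \<in> Wt \<nu>" by blast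
  \<comment> \<open>Elements of \<open>I\<close> have every weight, so a weight must be chosen for
    each summand.\<close>
  then obtain g where g: "\<And>a. a \<in> t \<Longrightarrow> g a \<in> \<Gamma>" "\<And>a. a \<in> t \<Longrightarrow> a \<in> Wt (g a)" by metis
  \<comment> \<open>Summands are grouped by chosen weight; the slot \<nu> is free, since \<nu> is
    not in \<Gamma>, and receives \<open>- y\<close>.\<close>
  define u where "u \<kappa> = (if \<kappa> = \<nu> then - y else \<Sum>a\<in>{a\<in>t. g a = \<kappa>}. uea_const (r a) * a)" for \<kappa>
  have "y = (\<Sum>\<kappa>\<in>g ` t. \<Sum>a\<in>{a\<in>t. g a = \<kappa>}. uea_const (r a) * a)"
    unfolding sum by (rule sum.image_gen[OF t(1)])
  also have "\<dots> = (\<Sum>\<kappa>\<in>g ` t. u \<kappa>)"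
    using g(1) \<nu> by (intro sum.cong) (auto simp: u_def)
  finally have "(\<Sum>\<kappa>\<in>insert \<nu> (g ` t). u \<kappa>) = 0"
    using g(1) \<nu> t(1) by (subst sum.insert) (auto simp: u_def)
  moreover have "u \<kappa> \<in> Wt \<kappa>" if "\<kappa> \<in> insert \<nu> (g ` t)" for \<kappa>
    unfolding u_def
    by (auto intro!: uea.subspace_sum[OF Wt_subspace] uea.subspace_scale[OF Wt_subspace]
        uea.subspace_neg[OF Wt_subspace] y g(2))
  ultimately have "u \<nu> \<in> I"
    using t(1) I_0 by (intro Wt_independent[of "insert \<nu> (g ` t)" u]) auto
  then show ?thesis using uea.subspace_neg[OF subspace_I, of "- y"] by (simp add: u_def)
qed

section \<open>The submodule generated by a singular vector\<close>

inductive F_word :: "'g uea \<Rightarrow> ('n \<Rightarrow> nat) \<Rightarrow> 'g uea \<Rightarrow> bool" for x where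
  F_word_0: "F_word x (\<lambda>_. 0) x"
| F_word_step: "F_word x \<beta> y \<Longrightarrow> F_word x (qstep i \<beta>) (F i * y)"

lemma F_word_Wt:
  assumes "F_word x \<beta> y" "x \<in> Wt \<nu>"
  shows "y \<in> Wt (\<nu> - qwt G \<beta>)"
  using assms
proof induction
  case F_word_0
  then show ?case by simp
next
  case (F_word_step \<beta> y i)
  from F_Wt[OF F_word_step.IH[OF F_word_step.prems], of i] show ?case by (simp add: qwt_qstep diff_diff_eq)
qed

text \<open>The preimage of U(n_-)x, where x is the image of \<open>x\<close> in the Verma module.
  Including \<open>I\<close> turns congruences modulo \<open>I\<close> into membership.\<close>

definition F_span :: "'g uea \<Rightarrow> 'g uea set" where
  "F_span x = uea.span ({y. \<exists>\<beta>. F_word x \<beta> y} \<union> I)"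

lemma F_span_subspace: "uea.subspace (F_span x)"
  unfolding F_span_def by (rule uea.subspace_span)

lemma F_word_F_span: "F_word x \<beta> y \<Longrightarrow> y \<in> F_span x"
  and I_F_span: "a \<in> I \<Longrightarrow> a \<in> F_span x"
  unfolding F_span_def by (blast intro: uea.span_base)+

lemma F_span_mult:
  assumes "\<And>\<beta> y. F_word x \<beta> y \<Longrightarrow> a * y \<in> F_span x" and "z \<in> F_span x"
  shows "a * z \<in> F_span x"
  using assms(2) unfolding F_span_def
proof (rule uea_span_mult[rotated])
  show "a * y \<in> uea.span ({y. \<exists>\<beta>. F_word x \<beta> y} \<union> I)" if "y \<in> {y. \<exists>\<beta>. F_word x \<beta> y} \<union> I" for y
    using that assms(1) I_F_span[OF I_mult] unfolding F_span_def by blast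
qed

lemma F_F_span: "z \<in> F_span x \<Longrightarrow> F i * z \<in> F_span x"
  by (rule F_span_mult) (auto intro: F_word_F_span F_word_step)

lemma F_word_H:
  assumes "F_word x \<beta> y" "x \<in> Wt \<nu>"
  shows "H i * y \<in> F_span x"
proof -
  have "H i * y - uea_const ((\<nu> - qwt G \<beta>) $ i) * y \<in> I"
    using F_word_Wt[OF assms] by (simp only: Wt_def mem_Collect_eq)
  then have "H i * y - uea_const ((\<nu> - qwt G \<beta>) $ i) * y + uea_const ((\<nu> - qwt G \<beta>) $ i) * y \<in> F_span x"
    by (intro uea.subspace_add[OF F_span_subspace] uea.subspace_scale[OF F_span_subspace] I_F_span
        F_word_F_span[OF assms(1)])
  then show ?thesis by simp
qed

text \<open>Moving e_j to the right past f_i costs a term h_j, which acts by a scalar on weight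
  vectors. At the end of the word e_j meets \<open>x\<close> and gives an element of
  \<open>I\<close>.\<close>

lemma F_word_E:
  assumes "F_word x \<beta> y" "x \<in> Wt \<nu>" "\<And>j. E j * x \<in> I"
  shows "E j * y \<in> F_span x"
  using assms(1)
proof induction
  case F_word_0
  then show ?case using assms(3) by (rule I_F_span)
next
  case (F_word_step \<beta> y i)
  have "E j * (F i * y) = F i * (E j * y) + (if j = i then H j * y else 0)"
    by (simp add: mult.assoc[symmetric] E_F distrib_right)
  moreover have "(if j = i then H j * y else 0) \<in> F_span x"
    using F_word_H[OF F_word_step.hyps assms(2)] uea.subspace_0[OF F_span_subspace] by simp
  ultimately show ?case
    using F_F_span[OF F_word_step.IH] uea.subspace_add[OF F_span_subspace] by simp
qed

lemma uea_gen_stabilizer_subalgebra: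
  assumes "uea.subspace S"
  shows "lie_subalgebra {z :: 'g. \<forall>y\<in>S. uea_gen z * y \<in> S}"
  unfolding lie_subalgebra_def clie.subspace_def
  by (auto simp: uea_gen_add uea_gen_scaleC uea_gen_lie distrib_right left_diff_distrib mult.assoc
      intro!: uea.subspace_0[OF assms] uea.subspace_add[OF assms] uea.subspace_scale[OF assms]
        uea.subspace_diff[OF assms])

text \<open>The Lie algebra elements preserving \<open>F_span x\<close> form a subalgebra containing
  the Chevalley generators, hence everything; induction on \<open>u\<close> does the rest.\<close>

lemma cyclic_submodule:
  assumes "x \<in> Wt \<nu>" "\<And>j. E j * x \<in> I"
  shows "u * x \<in> F_span x"
proof -
  let ?T = "{z :: 'g. \<forall>y\<in>F_span x. uea_gen z * y \<in> F_span x}"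
  have "?T = UNIV"
  proof (rule subalgebra_eq_UNIV)
    show "lie_subalgebra ?T" by (rule uea_gen_stabilizer_subalgebra[OF F_span_subspace])
    show "range (ee G) \<subseteq> ?T" "range (ff G) \<subseteq> ?T" "range (hh G) \<subseteq> ?T"
      using F_word_E[OF _ assms] F_word_H[OF _ assms(1)] F_F_span by (auto intro: F_span_mult)
  qed
  then have gen: "uea_gen z * y \<in> F_span x" if "y \<in> F_span x" for z y using that by blast
  show ?thesis
  proof (induction u rule: uea_induct)
    case (const c)
    show ?case using uea.subspace_scale[OF F_span_subspace F_word_F_span[OF F_word_0]] .
  next
    case (add a b)
    then show ?case by (simp add: distrib_right uea.subspace_add[OF F_span_subspace])
  next
    case (gen z u)
    then show ?case by (simp add: mult.assoc \<open>\<And>z y. y \<in> F_span x \<Longrightarrow> uea_gen z * y \<in> F_span x\<close>)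
  qed
qed

definition below :: "'n weight \<Rightarrow> 'n weight set" where
  "below \<nu> = {\<nu> - qwt G \<beta> | \<beta>. \<beta> \<noteq> (\<lambda>_. 0)}"

text \<open>For \<open>lam\<close> this plays the role of a complement to the constants modulo
  \<open>I\<close>; the constant part of \<open>u\<close> will be its vacuum expectation
  value.\<close>

definition Wt_below :: "'n weight \<Rightarrow> 'g uea set" where
  "Wt_below \<nu> = uea.span (\<Union>\<kappa>\<in>below \<nu>. Wt \<kappa>)"

lemma Wt_below_subspace: "uea.subspace (Wt_below \<nu>)"
  unfolding Wt_below_def by (rule uea.subspace_span)

lemma not_self_below: "\<nu> \<notin> below \<nu>"
proof
  assume "\<nu> \<in> below \<nu>"
  then obtain \<beta> where "\<beta> \<noteq> (\<lambda>_. 0)" "qwt G \<beta> = qwt G (\<lambda>_. 0)" by (auto simp: below_def)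
  then show False using injD[OF inj_qwt] by blast
qed

lemma Wt_Wt_below: "\<beta> \<noteq> (\<lambda>_. 0) \<Longrightarrow> y \<in> Wt (\<nu> - qwt G \<beta>) \<Longrightarrow> y \<in> Wt_below \<nu>"
  unfolding Wt_below_def below_def by (blast intro: uea.span_base)

lemma I_Wt_below: "a \<in> I \<Longrightarrow> a \<in> Wt_below \<nu>"
  using Wt_Wt_below[OF qstep_neq_0 I_Wt] .

lemma Wt_below_disjoint: "y \<in> Wt \<nu> \<Longrightarrow> y \<in> Wt_below \<nu> \<Longrightarrow> y \<in> I"
  using Wt_span_disjoint[OF _ not_self_below] unfolding Wt_below_def .

text \<open>A nonempty word starts with some f_i and has strictly lower weight, so only the empty
  word contributes to the top. The first conclusion separates weights, the second feeds the dual
  ideal \<open>J\<close>.\<close>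

lemma cyclic_decomposition:
  assumes "x \<in> Wt \<nu>" "\<And>j. E j * x \<in> I"
  obtains c where "u * x - uea_const c * x \<in> Wt_below \<nu>"
    and "u * x - uea_const c * x \<in> uea.span ({F i * z | i z. True} \<union> I)"
proof -
  \<comment> \<open>Using words with both properties gives one constant for both
    conclusions.\<close>
  let ?B = "({F i * z | i z. True} \<inter> Wt_below \<nu>) \<union> I"
  have "y \<in> insert x ?B" if y: "F_word x \<beta> y" for y \<beta>
    using y
  proof cases
    case F_word_0
    then show ?thesis by simp
  next
    case (F_word_step \<gamma> z i)
    have "y \<in> Wt_below \<nu>"
      using F_word_Wt[OF y assms(1)] F_word_step(1) by (intro Wt_Wt_below[OF qstep_neq_0]) simp
    then show ?thesis using F_word_step(2) by blast
  qed
  then have "{y. \<exists>\<beta>. F_word x \<beta> y} \<union> I \<subseteq> insert x ?B" by blast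
  then have "u * x \<in> uea.span (insert x ?B)"
    using cyclic_submodule[OF assms, of u] uea.span_mono unfolding F_span_def by blast
  then obtain c where c: "u * x - uea_const c * x \<in> uea.span ?B"
    unfolding uea.span_breakdown_eq by blast
  have "?B \<subseteq> Wt_below \<nu>" using I_Wt_below by blast
  then have "uea.span ?B \<subseteq> Wt_below \<nu>" by (rule uea.span_minimal[OF _ Wt_below_subspace])
  moreover have "uea.span ?B \<subseteq> uea.span ({F i * z | i z. True} \<union> I)" by (rule uea.span_mono) blast
  ultimately show ?thesis using c that by blast
qed

text \<open>The submodule generated by \<open>x\<close> is zero or everything. In the second case 1
  would be a combination of vectors of weight strictly below \<lambda>.\<close>

lemma singular_vector_trivial:
  assumes x: "x \<in> Wt (lam - qwt G \<beta>)" and \<beta>: "\<beta> \<noteq> (\<lambda>_. 0)" and E: "\<And>j. E j * x \<in> I"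
  shows "x \<in> I"
proof -
  let ?N = "range (\<lambda>u. ket G lam (u * x))"
  have "verma_submodule G lam ?N"
    unfolding verma_submodule_def
  proof (intro conjI ballI allI)
    show "?N \<subseteq> verma G lam" by (auto simp: verma_def)
    show "ket G lam 0 \<in> ?N" by (rule range_eqI[of _ _ 0]) simp
  next
    fix S T assume "S \<in> ?N" "T \<in> ?N"
    then obtain u v where "S = ket G lam (u * x)" "T = ket G lam (v * x)" by blast
    then show "ket_add G lam S T \<in> ?N"
      by (intro range_eqI[of _ _ "u + v"]) (simp add: ket_add_ket distrib_right)
  next
    fix u S assume "S \<in> ?N"
    then obtain v where "S = ket G lam (v * x)" by blast
    then show "ket_act G lam u S \<in> ?N"
      by (intro range_eqI[of _ _ "u * v"]) (simp add: ket_act_ket mult.assoc)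
  qed
  with irreducible consider "?N = {ket G lam 0}" | "?N = verma G lam"
    unfolding verma_irreducible_def by blast
  then show ?thesis
  proof cases
    case 1
    then have "ket G lam (1 * x) = ket G lam 0" by blast
    then show ?thesis by (simp add: ket_eq_iff)
  next
    case 2
    then have "ket G lam 1 \<in> ?N" by (simp add: verma_def)
    then obtain u where u: "1 - u * x \<in> I" by (auto simp: ket_eq_iff)
    obtain c where c: "u * x - uea_const c * x \<in> Wt_below (lam - qwt G \<beta>)"
      using cyclic_decomposition[OF x E] by blast
    have "below (lam - qwt G \<beta>) \<subseteq> below lam"
    proof
      fix \<kappa> assume "\<kappa> \<in> below (lam - qwt G \<beta>)"
      then obtain \<gamma> where "\<kappa> = lam - qwt G \<beta> - qwt G \<gamma>" by (auto simp: below_def)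
      then have "\<kappa> = lam - qwt G (\<lambda>i. \<beta> i + \<gamma> i)"
        by (simp add: qwt_def vec_eq_iff sum.distrib algebra_simps)
      moreover have "(\<lambda>i. \<beta> i + \<gamma> i) \<noteq> (\<lambda>_. 0)" using \<beta> by (auto simp: fun_eq_iff)
      ultimately show "\<kappa> \<in> below lam" by (auto simp: below_def)
    qed
    then have "Wt_below (lam - qwt G \<beta>) \<subseteq> Wt_below lam"
      unfolding Wt_below_def by (intro uea.span_mono) blast
    with c have "u * x - uea_const c * x \<in> Wt_below lam" by blast
    moreover have "x \<in> Wt_below lam" using x \<beta> by (rule Wt_Wt_below[rotated])
    \<comment> \<open>The three summands telescope to 1.\<close>
    ultimately have "(1 - u * x) + (u * x - uea_const c * x) + uea_const c * x \<in> Wt_below lam"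
      using I_Wt_below[OF u]
      by (intro uea.subspace_add[OF Wt_below_subspace] uea.subspace_scale[OF Wt_below_subspace])
    then have "1 \<in> I" using Wt_below_disjoint[OF one_Wt] by simp
    with one_notin_I show ?thesis by blast
  qed
qed

lemma E_one_in_I: "E j * 1 \<in> I"
  by (simp add: E_in_I)

lemma highest_weight_decomposition:
  obtains c where "u - uea_const c \<in> Wt_below lam"
    and "u - uea_const c \<in> uea.span ({F i * z | i z. True} \<union> I)"
  using cyclic_decomposition[OF one_Wt E_one_in_I, of u] by auto

text \<open>The top weight space is one-dimensional: after removing the constant, the rest has
  weight \<lambda> and also lies below \<lambda>.\<close>

lemma Wt_lam:
  assumes "u \<in> Wt lam"
  obtains c where "u - uea_const c \<in> I"
proof -
  obtain c where c: "u - uea_const c \<in> Wt_below lam" by (rule highest_weight_decomposition)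
  have "u - uea_const c * 1 \<in> Wt lam"
    using assms one_Wt by (intro uea.subspace_diff[OF Wt_subspace] uea.subspace_scale[OF Wt_subspace])
  with c show ?thesis using Wt_below_disjoint that by auto
qed

text \<open>All weights lie in \<lambda> - Q_+, since a constant plus a lower part exhausts the
  algebra.\<close>

lemma verma_weights:
  assumes "y \<in> Wt \<nu>" "\<And>\<beta>. \<nu> \<noteq> lam - qwt G \<beta>"
  shows "y \<in> I"
proof -
  obtain c where c: "y - uea_const c \<in> Wt_below lam" by (rule highest_weight_decomposition)
  let ?\<Gamma> = "range (\<lambda>\<beta>. lam - qwt G \<beta>)"
  have "Wt_below lam \<subseteq> uea.span (\<Union>\<nu>\<in>?\<Gamma>. Wt \<nu>)"
    unfolding Wt_below_def below_def by (intro uea.span_mono) blast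
  moreover have "1 \<in> uea.span (\<Union>\<nu>\<in>?\<Gamma>. Wt \<nu>)"
    using one_Wt by (intro uea.span_base UN_I[of lam]) (auto intro: range_eqI[of _ _ "\<lambda>_. 0"])
  ultimately have "(y - uea_const c) + uea_const c * 1 \<in> uea.span (\<Union>\<nu>\<in>?\<Gamma>. Wt \<nu>)"
    using c by (intro uea.span_add uea.span_scale) auto
  then show ?thesis using assms by (intro Wt_span_disjoint[of y \<nu> ?\<Gamma>]) auto
qed

lemma all_weights: "u \<in> uea.span (\<Union>\<beta>. Wt (lam - qwt G \<beta>))"
proof -
  obtain c where c: "u - uea_const c \<in> Wt_below lam" by (rule highest_weight_decomposition)
  have "Wt_below lam \<subseteq> uea.span (\<Union>\<beta>. Wt (lam - qwt G \<beta>))"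
    unfolding Wt_below_def below_def by (intro uea.span_mono) blast
  moreover have "1 \<in> uea.span (\<Union>\<beta>. Wt (lam - qwt G \<beta>))"
    using one_Wt by (intro uea.span_base UN_I[of "\<lambda>_. 0"]) auto
  ultimately have "(u - uea_const c) + uea_const c * 1 \<in> uea.span (\<Union>\<beta>. Wt (lam - qwt G \<beta>))"
    using c by (intro uea.span_add uea.span_scale) auto
  then show ?thesis by simp
qed


section \<open>Vacuum expectation values\<close>

text \<open>f_i lowers every weight, so its image has no component along the highest weight
  vector.\<close>

lemma F_mult_Wt_below: "F i * u \<in> Wt_below lam"
proof -
  have "F i * y \<in> Wt_below lam" if "y \<in> Wt (lam - qwt G \<beta>)" for y \<beta>
    using F_Wt[OF that, of i] by (intro Wt_Wt_below[OF qstep_neq_0[of i \<beta>]]) (simp add: qwt_qstep diff_diff_eq)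
  then show ?thesis
    using uea_span_mult[OF _ all_weights, of "F i"] unfolding Wt_below_def by blast
qed

text \<open>The operator kills weight \<lambda> modulo \<open>I\<close> and preserves every lower
  weight.\<close>

lemma H_diff_mult_Wt_below: "(H i - uea_const (lam $ i)) * u \<in> Wt_below lam"
proof -
  have "(H i - uea_const (lam $ i)) * y \<in> Wt_below lam" if y: "y \<in> Wt (lam - qwt G \<beta>)" for y \<beta>
  proof (cases "\<beta> = (\<lambda>_. 0)")
    case True
    then show ?thesis using y I_Wt_below by (simp add: Wt_def left_diff_distrib)
  next
    case False
    then have below: "y \<in> Wt_below lam" using y by (rule Wt_Wt_below)
    have "H i * y - uea_const ((lam - qwt G \<beta>) $ i) * y \<in> Wt_below lam"
      using y I_Wt_below unfolding Wt_def by blast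
    then have "H i * y - uea_const ((lam - qwt G \<beta>) $ i) * y - uea_const (qwt G \<beta> $ i) * y \<in> Wt_below lam"
      by (rule uea.subspace_diff[OF Wt_below_subspace _ uea.subspace_scale[OF Wt_below_subspace below]])
    moreover have "H i * y - uea_const ((lam - qwt G \<beta>) $ i) * y - uea_const (qwt G \<beta> $ i) * y =
        (H i - uea_const (lam $ i)) * y"
      by (simp add: uea_const_diff algebra_simps)
    ultimately show ?thesis by simp
  qed
  then show ?thesis
    using uea_span_mult[OF _ all_weights, of "H i - uea_const (lam $ i)"] unfolding Wt_below_def by blast
qed

lemma J_subset_Wt_below: "J \<subseteq> Wt_below lam"
proof -
  let ?g = "uea_gen ` nminus G \<union> range (\<lambda>i. H i - uea_const (lam $ i))"
  \<comment> \<open>The right ideal generated by \<open>?g\<close>, written as a linear span so that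
    membership can be tested on single products.\<close>
  let ?R = "uea.span {a * u | a u. a \<in> ?g}"
  have "right_ideal ?R"
    unfolding right_ideal_def
  proof (intro conjI ballI allI)
    fix u a assume "a \<in> ?R"
    moreover have "uea.subspace {a. a * u \<in> ?R}"
      by (rule uea_subspaceI) (simp_all add: distrib_right mult.assoc uea.span_zero uea.span_add uea.span_scale)
    moreover have "b * u \<in> ?R" if "b \<in> {a * u | a u. a \<in> ?g}" for b
    proof -
      from that obtain a v where "b = a * v" "a \<in> ?g" by blast
      then show ?thesis by (intro uea.span_base CollectI exI[of _ a] exI[of _ "v * u"]) (simp add: mult.assoc)
    qed
    ultimately show "a * u \<in> ?R" using uea.span_induct by blast
  qed (auto intro: uea.span_zero uea.span_add)
  moreover have "?g \<subseteq> ?R"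
  proof
    fix a assume "a \<in> ?g"
    then have "a * 1 \<in> ?R" by (intro uea.span_base) blast
    then show "a \<in> ?R" by simp
  qed
  ultimately have "J \<subseteq> ?R"
    unfolding dual_verma_ideal_def by (intro hull_minimal)
  also have "?R \<subseteq> Wt_below lam"
  proof (rule uea.span_minimal[OF _ Wt_below_subspace])
    \<comment> \<open>This subalgebra contains all f_i, hence the whole of n_-.\<close>
    let ?T = "{z :: 'g. \<forall>u. uea_gen z * u \<in> Wt_below lam}"
    have "lie_subalgebra ?T"
      unfolding lie_subalgebra_def clie.subspace_def
      by (auto simp: uea_gen_add uea_gen_scaleC uea_gen_lie distrib_right left_diff_distrib mult.assoc
          intro!: uea.subspace_0[OF Wt_below_subspace] uea.subspace_add[OF Wt_below_subspace]
            uea.subspace_scale[OF Wt_below_subspace] uea.subspace_diff[OF Wt_below_subspace])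
    then have "nminus G \<subseteq> ?T"
      unfolding nminus_def using F_mult_Wt_below by (intro hull_minimal) auto
    then show "{a * u | a u. a \<in> ?g} \<subseteq> Wt_below lam" using H_diff_mult_Wt_below by blast
  qed
  finally show ?thesis .
qed

text \<open>Constants have weight \<lambda>, while \<open>I\<close> and \<open>J\<close> lie in
  \<open>Wt_below lam\<close>. This is the uniqueness behind \<open>vev\<close>.\<close>

lemma const_in_I_plus_J:
  assumes "uea_const c = l + r" "l \<in> I" "r \<in> J"
  shows "c = 0"
proof (rule ccontr)
  assume "c \<noteq> 0"
  have "uea_const c * 1 \<in> Wt_below lam"
    using assms J_subset_Wt_below I_Wt_below[OF assms(2)] uea.subspace_add[OF Wt_below_subspace] by auto
  moreover have "uea_const c * 1 \<in> Wt lam" using uea.subspace_scale[OF Wt_subspace one_Wt] .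
  ultimately have "uea_const c * 1 \<in> I" by (rule Wt_below_disjoint[rotated])
  then have "uea_const (1 / c) * (uea_const c * 1) \<in> I" by (rule I_mult)
  with \<open>c \<noteq> 0\<close> have "1 \<in> I" by (simp add: uea_const_mult[symmetric])
  with one_notin_I show False ..
qed

lemma vev_eqI:
  assumes "u = uea_const c + l + r" "l \<in> I" "r \<in> J"
  shows "vev G lam u = c"
  unfolding vev_def
proof (rule the_equality)
  show "\<exists>l\<in>I. \<exists>r\<in>J. u = uea_const c + l + r" using assms by blast
next
  fix c' assume "\<exists>l\<in>I. \<exists>r\<in>J. u = uea_const c' + l + r"
  then obtain l' r' where "l' \<in> I" "r' \<in> J" "u = uea_const c' + l' + r'" by blast
  then have "uea_const (c' - c) = (l - l') + (r - r')" "l - l' \<in> I" "r - r' \<in> J"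
    using assms by (auto simp: uea_const_diff algebra_simps intro: I_diff J_diff)
  then have "c' - c = 0" by (rule const_in_I_plus_J)
  then show "c' = c" by simp
qed

text \<open>Existence behind \<open>vev\<close>: the non-constant part is spanned by
  \<open>I\<close> and by products starting with f_i, which lie in \<open>J\<close>.\<close>

lemma vev_decomposition:
  obtains l r where "u = uea_const (vev G lam u) + l + r" "l \<in> I" "r \<in> J"
proof -
  obtain c where c: "u - uea_const c \<in> uea.span ({F i * z | i z. True} \<union> I)"
    by (rule highest_weight_decomposition)
  let ?S = "{l + r | l r. l \<in> I \<and> r \<in> J}"
  have "uea.subspace ?S" by (rule uea.subspace_sums[OF subspace_I subspace_J])
  moreover have "{F i * z | i z. True} \<union> I \<subseteq> ?S"
  proof
    fix a assume "a \<in> {F i * z | i z. True} \<union> I"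
    then have "a \<in> I \<or> a \<in> J" using F_in_J by blast
    then have "\<exists>l r. a = l + r \<and> l \<in> I \<and> r \<in> J"
      using I_0 J_0 by (metis add_0 add_0_right)
    then show "a \<in> ?S" by blast
  qed
  ultimately have "u - uea_const c \<in> ?S" using c uea.span_minimal by blast
  then obtain l r where lr: "u - uea_const c = l + r" "l \<in> I" "r \<in> J" by blast
  then have u: "u = uea_const c + l + r" by (simp add: algebra_simps)
  then have "vev G lam u = c" using lr by (intro vev_eqI)
  with u have "u = uea_const (vev G lam u) + l + r" by simp
  then show ?thesis using lr(2,3) by (rule that)
qed

lemma vev_add: "vev G lam (u + v) = vev G lam u + vev G lam v"
proof -
  obtain l r where u: "u = uea_const (vev G lam u) + l + r" "l \<in> I" "r \<in> J" by (rule vev_decomposition)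
  obtain l' r' where v: "v = uea_const (vev G lam v) + l' + r'" "l' \<in> I" "r' \<in> J" by (rule vev_decomposition)
  have "u + v = (uea_const (vev G lam u) + l + r) + (uea_const (vev G lam v) + l' + r')"
    using u(1) v(1) by simp
  also have "\<dots> = uea_const (vev G lam u + vev G lam v) + (l + l') + (r + r')"
    by (simp add: uea_const_add algebra_simps)
  finally show ?thesis using I_add[OF u(2) v(2)] J_add[OF u(3) v(3)] by (rule vev_eqI)
qed

lemma vev_scale: "vev G lam (uea_const c * u) = c * vev G lam u"
proof -
  obtain l r where u: "u = uea_const (vev G lam u) + l + r" "l \<in> I" "r \<in> J" by (rule vev_decomposition)
  have "uea_const c * u = uea_const c * (uea_const (vev G lam u) + l + r)"
    using u(1) by simp
  also have "\<dots> = uea_const (c * vev G lam u) + uea_const c * l + uea_const c * r"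
    by (simp add: uea_const_mult distrib_left)
  finally show ?thesis
    using I_mult[OF u(2)] uea.subspace_scale[OF subspace_J u(3)] by (rule vev_eqI)
qed

lemma vev_I: "l \<in> I \<Longrightarrow> vev G lam l = 0"
  by (rule vev_eqI[of _ _ l 0]) (simp_all add: J_0)

lemma vev_J: "r \<in> J \<Longrightarrow> vev G lam r = 0"
  by (rule vev_eqI[of _ _ 0 r]) (simp_all add: I_0)

lemma vev_const: "vev G lam (uea_const c) = c"
  by (rule vev_eqI[of _ _ 0 0]) (simp_all add: I_0 J_0)

lemma vev_0 [simp]: "vev G lam 0 = 0"
  using vev_I[OF I_0] .

lemma vev_sum: "vev G lam (\<Sum>i\<in>A. f i) = (\<Sum>i\<in>A. vev G lam (f i))"
  by (induction A rule: infinite_finite_induct) (simp_all add: vev_add)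

lemma vev_cong_I: "u - v \<in> I \<Longrightarrow> vev G lam u = vev G lam v"
  using vev_add[of "u - v" v] by (simp add: vev_I)

lemma vev_cong_J: "u - v \<in> J \<Longrightarrow> vev G lam u = vev G lam v"
  using vev_add[of "u - v" v] by (simp add: vev_J)

text \<open>Changing the left representative alters the product by an element of \<open>J\<close>,
  changing the right one by an element of \<open>I\<close>; \<open>vev\<close> vanishes on
  both.\<close>

lemma verma_pairing_eq: "verma_pairing G lam (bra G lam a) (ket G lam b) = vev G lam (a * b)"
  unfolding verma_pairing_def
proof (rule the_equality)
  show "\<exists>a' b'. bra G lam a = bra G lam a' \<and> ket G lam b = ket G lam b' \<and> vev G lam (a * b) = vev G lam (a' * b')"
    by blast
next
  fix c assume "\<exists>a' b'. bra G lam a = bra G lam a' \<and> ket G lam b = ket G lam b' \<and> c = vev G lam (a' * b')"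
  then obtain a' b' where "a - a' \<in> J" "b - b' \<in> I" and c: "c = vev G lam (a' * b')"
    unfolding bra_eq_iff ket_eq_iff by blast
  then have "a * b - a' * b \<in> J" "a' * b - a' * b' \<in> I"
    using J_mult[of "a - a'" b] I_mult[of "b - b'" a'] by (simp_all add: algebra_simps)
  then show "c = vev G lam (a * b)" using c vev_cong_I vev_cong_J by metis
qed

lemma ket_weight_space_iff: "ket G lam x \<in> ket_weight_space G lam \<nu> \<longleftrightarrow> x \<in> Wt \<nu>"
  by (auto simp: ket_weight_space_def verma_def ket_act_ket ket_eq_iff Wt_def)


section \<open>Whittaker vectors\<close>

text \<open>Extends the Whittaker relation to vertices without a j-th predecessor, where e_j would
  produce a weight that does not occur.\<close>

lemma Whittaker_E:
  assumes wt: "\<And>\<beta>. x \<beta> \<in> Wt (lam - qwt G \<beta>)"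
    and E: "\<And>i \<beta>. E i * x (qstep i \<beta>) - uea_const (\<mu> i) * x \<beta> \<in> I"
  shows "E j * x \<beta> - uea_const (\<mu> j) * lower j x \<beta> \<in> I"
proof (cases rule: lower_cases[of \<beta> j])
  case zero
  have "E j * x \<beta> \<in> I"
  proof (rule verma_weights[OF E_Wt[OF wt]])
    fix \<gamma>
    show "lam - qwt G \<beta> + simple_root G j \<noteq> lam - qwt G \<gamma>"
      using minus_simple_root_notin_qwt[of \<beta> j \<gamma>, OF zero] by (simp add: algebra_simps)
  qed
  then show ?thesis by (simp add: lower_eq_0[of \<beta>, OF zero])
next
  case (step \<gamma>)
  then show ?thesis using E by simp
qed

lemma lower_Wt:
  assumes wt: "\<And>\<beta>. x \<beta> \<in> Wt (lam - qwt G \<beta>)"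
  shows "lower i x \<beta> \<in> Wt (lam - qwt G \<beta> + simple_root G i)"
proof (cases rule: lower_cases[of \<beta> i])
  case zero
  then show ?thesis by (simp add: lower_eq_0 uea.subspace_0[OF Wt_subspace])
next
  case (step \<gamma>)
  then show ?thesis using wt[of \<gamma>] by (simp add: qwt_qstep)
qed

text \<open>The difference of the two sides is a singular vector of weight \<open>\<lambda> - \<beta>\<close>, because
  \<open>v(\<beta> + \<alpha> j) - v(\<beta>) = d j (\<lambda> - \<beta>)(h j)\<close>; irreducibility makes it vanish.\<close>

lemma Whittaker_recursion:
  assumes wt: "\<And>\<beta>. x \<beta> \<in> Wt (lam - qwt G \<beta>)"
    and E: "\<And>i \<beta>. E i * x (qstep i \<beta>) - uea_const (\<mu> i) * x \<beta> \<in> I"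
  shows "uea_const (vertex_weight G lam \<beta>) * x \<beta> -
    (\<Sum>i\<in>UNIV. uea_const (of_nat (dd G i) * \<mu> i) * (F i * lower i x \<beta>)) \<in> I"
proof (induction \<beta> rule: measure_induct_rule[of "\<lambda>\<beta>. \<Sum>i\<in>UNIV. \<beta> i"])
  case (less \<beta>)
  let ?v = "vertex_weight G lam"
  let ?c = "\<lambda>i. of_nat (dd G i) * \<mu> i"
  define r where "r \<beta> = uea_const (?v \<beta>) * x \<beta> - (\<Sum>i\<in>UNIV. uea_const (?c i) * (F i * lower i x \<beta>))" for \<beta>
  have EF: "E j * (F i * y) = F i * (E j * y) + (if j = i then H j * y else 0)" for i j y
    by (simp add: mult.assoc[symmetric] E_F distrib_right)
  have "E j * (\<Sum>i\<in>UNIV. uea_const (?c i) * (F i * lower i x \<beta>)) =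
      (\<Sum>i\<in>UNIV. uea_const (?c i) * (F i * (E j * lower i x \<beta>))
        + (if j = i then uea_const (?c i) * (H j * lower j x \<beta>) else 0))" for j
    unfolding sum_distrib_left
    by (intro sum.cong HOL.refl) (auto simp: uea_const_left_commute[of "E j"] EF distrib_left)
  then have Er: "E j * r \<beta> = uea_const (?v \<beta>) * (E j * x \<beta>) -
      ((\<Sum>i\<in>UNIV. uea_const (?c i) * (F i * (E j * lower i x \<beta>))) + uea_const (?c j) * (H j * lower j x \<beta>))" for j
    by (simp add: r_def right_diff_distrib uea_const_left_commute[of "E j"] sum.distrib)
  \<comment> \<open>The Whittaker relation at \<beta> - \<alpha>_i. If this vertex is missing,
    exchanging the two lowerings shows that both terms vanish.\<close>
  have E_lower: "E j * lower i x \<beta> - uea_const (\<mu> j) * lower j (lower i x) \<beta> \<in> I" for i j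
  proof (cases rule: lower_cases[of \<beta> i])
    case zero
    then show ?thesis by (simp add: lower_commute[of j i] lower_eq_0 I_0)
  next
    case (step \<gamma>)
    then show ?thesis
      using Whittaker_E[OF wt E, of j \<gamma>] by (simp add: lower_commute[of j i])
  qed
  have "E j * r \<beta> \<in> I" for j
  proof (cases rule: lower_cases[of \<beta> j])
    case zero
    have "uea_const (?v \<beta>) * (E j * x \<beta>) \<in> I" using I_mult Whittaker_E[OF wt E, of j \<beta>] by (simp add: lower_eq_0 zero)
    moreover have "uea_const (?c i) * (F i * (E j * lower i x \<beta>)) \<in> I" for i
      using I_mult[OF I_mult[OF E_lower[of j i]]] by (simp add: lower_eq_0 zero)
    ultimately have "uea_const (?v \<beta>) * (E j * x \<beta>) -
        (\<Sum>i\<in>UNIV. uea_const (?c i) * (F i * (E j * lower i x \<beta>))) \<in> I"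
      by (rule I_diff[OF _ I_sum])
    then show ?thesis unfolding Er lower_eq_0[of \<beta>, OF zero] by simp
  next
    case (step \<gamma>)
    let ?h = "(lam - qwt G \<gamma>) $ j"
    \<comment> \<open>These three errors lie in \<open>I\<close>, as does \<open>r \<gamma>\<close>
      by induction; \<open>E j * r \<beta>\<close> is a combination of them.\<close>
    define eA where "eA = E j * x \<beta> - uea_const (\<mu> j) * x \<gamma>"
    define eB where "eB i = E j * lower i x \<beta> - uea_const (\<mu> j) * lower i x \<gamma>" for i
    define eH where "eH = H j * x \<gamma> - uea_const ?h * x \<gamma>"
    have "eA \<in> I" using E step by (simp add: eA_def)
    moreover have "eB i \<in> I" for i using E_lower[of j i] by (simp add: eB_def lower_step[OF step])
    moreover have "eH \<in> I" using wt[of \<gamma>] by (simp only: eH_def Wt_def mem_Collect_eq)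
    moreover have "r \<gamma> \<in> I"
      using less.IH[of \<gamma>] unfolding r_def step by (simp add: sum_qstep)
    ultimately have "uea_const (?v \<beta>) * eA - ((\<Sum>i\<in>UNIV. uea_const (?c i) * (F i * eB i)) + uea_const (?c j) * eH)
        + uea_const (\<mu> j) * r \<gamma> \<in> I"
      by (intro I_diff I_add I_sum I_mult)
    also have "uea_const (?v \<beta>) * eA - ((\<Sum>i\<in>UNIV. uea_const (?c i) * (F i * eB i)) + uea_const (?c j) * eH)
        + uea_const (\<mu> j) * r \<gamma> = E j * r \<beta>"
    proof -
      \<comment> \<open>The increment of the vertex weight cancels the h_j term coming from the
        commutator of e_j and f_j, leaving \<open>\<mu> j\<close> times the residue at
        \<gamma>.\<close>
      have v: "?v \<beta> = ?v \<gamma> + of_nat (dd G j) * ?h" unfolding step by (rule vertex_weight_qstep)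
      have FB: "(\<Sum>i\<in>UNIV. uea_const (?c i) * (F i * (E j * lower i x \<beta>))) =
          (\<Sum>i\<in>UNIV. uea_const (?c i) * (F i * eB i)) +
          uea_const (\<mu> j) * (\<Sum>i\<in>UNIV. uea_const (?c i) * (F i * lower i x \<gamma>))"
        unfolding sum_distrib_left sum.distrib[symmetric]
      proof (intro sum.cong HOL.refl)
        fix i
        have "uea_const (?c i) * (F i * (uea_const (\<mu> j) * lower i x \<gamma>)) =
            uea_const (\<mu> j) * (uea_const (?c i) * (F i * lower i x \<gamma>))"
          by (simp add: uea_const_left_commute[of "F i"] uea_const_left_commute[of "uea_const (?c i)" "\<mu> j"])
        then show "uea_const (?c i) * (F i * (E j * lower i x \<beta>)) = uea_const (?c i) * (F i * eB i) +
            uea_const (\<mu> j) * (uea_const (?c i) * (F i * lower i x \<gamma>))"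
          by (simp add: eB_def right_diff_distrib)
      qed
      have "uea_const (?v \<beta>) * (uea_const (\<mu> j) * x \<gamma>) =
          uea_const (\<mu> j) * (uea_const (?v \<gamma>) * x \<gamma>) + uea_const (?c j) * (uea_const ?h * x \<gamma>)"
        unfolding v mult.assoc[symmetric] uea_const_mult[symmetric] distrib_right[symmetric] uea_const_add[symmetric]
        by (simp add: algebra_simps)
      then show ?thesis
        unfolding Er FB lower_step[OF step] by (simp add: eA_def eH_def r_def right_diff_distrib algebra_simps)
    qed
    finally show ?thesis .
  qed
  moreover have "r \<beta> \<in> Wt (lam - qwt G \<beta>)"
  proof -
    have "F i * lower i x \<beta> \<in> Wt (lam - qwt G \<beta>)" for i
      using F_Wt[OF lower_Wt[of x i \<beta>, OF wt], of i] by simp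
    then show ?thesis unfolding r_def
      by (intro uea.subspace_diff[OF Wt_subspace] uea.subspace_sum[OF Wt_subspace]
          uea.subspace_scale[OF Wt_subspace] wt)
  qed
  \<comment> \<open>At the origin the vertex weight and all lowered terms vanish; this case lies
    outside \<open>singular_vector_trivial\<close>.\<close>
  moreover have "r \<beta> \<in> I" if "\<beta> = (\<lambda>_. 0)"
    using that by (simp add: r_def vertex_weight_0 lower_def I_0)
  ultimately have "r \<beta> \<in> I" using singular_vector_trivial by blast
  then show ?case by (simp add: r_def)
qed

text \<open>Multiply the recursion for \<open>x\<close> by \<open>y \<beta>\<close> on the left and
  let f_i act on \<open>y\<close>, where it becomes the scalar \<open>\<mu>' i\<close> modulo
  \<open>J\<close>.\<close>

lemma pairing_recursion:
  assumes wt: "\<And>\<beta>. x \<beta> \<in> Wt (lam - qwt G \<beta>)"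
    and E: "\<And>i \<beta>. E i * x (qstep i \<beta>) - uea_const (\<mu> i) * x \<beta> \<in> I"
    and F: "\<And>i \<beta>. y (qstep i \<beta>) * F i - uea_const (\<mu>' i) * y \<beta> \<in> J"
  shows "vertex_weight G lam \<beta> * vev G lam (y \<beta> * x \<beta>) =
    (\<Sum>i\<in>UNIV. of_nat (dd G i) * \<mu> i * \<mu>' i * lower i (\<lambda>\<beta>. vev G lam (y \<beta> * x \<beta>)) \<beta>)"
proof -
  let ?c = "\<lambda>i. of_nat (dd G i) * \<mu> i"
  have step: "vev G lam (y \<beta> * (F i * lower i x \<beta>)) = \<mu>' i * lower i (\<lambda>\<beta>. vev G lam (y \<beta> * x \<beta>)) \<beta>" for i
  proof (cases rule: lower_cases[of \<beta> i])
    case zero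
    then show ?thesis by (simp add: lower_eq_0)
  next
    case (step \<gamma>)
    have "(y \<beta> * F i - uea_const (\<mu>' i) * y \<gamma>) * x \<gamma> \<in> J" unfolding step by (intro J_mult F)
    then have "vev G lam (y \<beta> * (F i * x \<gamma>)) = vev G lam (uea_const (\<mu>' i) * (y \<gamma> * x \<gamma>))"
      by (intro vev_cong_J) (simp add: left_diff_distrib mult.assoc)
    then show ?thesis by (simp add: lower_step[OF step] vev_scale)
  qed
  have "vertex_weight G lam \<beta> * vev G lam (y \<beta> * x \<beta>) =
      vev G lam (y \<beta> * (uea_const (vertex_weight G lam \<beta>) * x \<beta>))"
    by (simp add: uea_const_left_commute[of "y \<beta>"] vev_scale)
  also have "\<dots> = vev G lam (y \<beta> * (\<Sum>i\<in>UNIV. uea_const (?c i) * (F i * lower i x \<beta>)))"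
    using I_mult[OF Whittaker_recursion[OF wt E], of "y \<beta>" \<beta>]
    by (intro vev_cong_I) (simp add: right_diff_distrib)
  also have "\<dots> = (\<Sum>i\<in>UNIV. ?c i * vev G lam (y \<beta> * (F i * lower i x \<beta>)))"
    by (simp add: sum_distrib_left vev_sum uea_const_left_commute[of "y \<beta>"] vev_scale)
  finally show ?thesis by (simp add: step mult.assoc)
qed

lemma Whittaker_pairing:
  assumes w: "whittaker_ket G lam \<mu> w" and w': "whittaker_bra G lam \<mu>' w'"
  defines "P \<equiv> \<lambda>\<beta>. verma_pairing G lam (w' \<beta>) (w \<beta>)"
  shows "P (\<lambda>_. 0) = 1"
    and "vertex_weight G lam \<beta> * P \<beta> =
      (\<Sum>i\<in>UNIV. of_nat (dd G i) * \<mu> i * \<mu>' i * lower i P \<beta>)"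
proof -
  have "w \<beta> \<in> range (ket G lam)" for \<beta>
    using w by (simp add: whittaker_ket_def verma_completion_def ket_weight_space_def verma_def)
  then have "\<exists>x. w \<beta> = ket G lam x" for \<beta> by blast
  then obtain x where x: "w = (\<lambda>\<beta>. ket G lam (x \<beta>))" by metis
  have "w' \<beta> \<in> range (bra G lam)" for \<beta>
    using w' by (simp add: whittaker_bra_def dual_verma_completion_def bra_weight_space_def dual_verma_def)
  then have "\<exists>y. w' \<beta> = bra G lam y" for \<beta> by blast
  then obtain y where y: "w' = (\<lambda>\<beta>. bra G lam (y \<beta>))" by metis
  have wt: "x \<beta> \<in> Wt (lam - qwt G \<beta>)" for \<beta>
    using w by (simp add: whittaker_ket_def verma_completion_def x ket_weight_space_iff)
  have E: "E i * x (qstep i \<beta>) - uea_const (\<mu> i) * x \<beta> \<in> I" for i \<beta>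
    using w by (simp add: whittaker_ket_def x ket_act_ket ket_eq_iff)
  have F: "y (qstep i \<beta>) * F i - uea_const (\<mu>' i) * y \<beta> \<in> J" for i \<beta>
    using w' by (simp add: whittaker_bra_def y bra_act_bra bra_eq_iff uea_const_commute[of "y _"])
  have P: "P = (\<lambda>\<beta>. vev G lam (y \<beta> * x \<beta>))"
    by (simp add: P_def x y verma_pairing_eq)
  show "vertex_weight G lam \<beta> * P \<beta> =
      (\<Sum>i\<in>UNIV. of_nat (dd G i) * \<mu> i * \<mu>' i * lower i P \<beta>)"
    unfolding P by (rule pairing_recursion[OF wt E F])
  have "x (\<lambda>_. 0) \<in> Wt lam" using wt[of "\<lambda>_. 0"] by simp
  \<comment> \<open>The bottom component is a constant modulo \<open>I\<close>, and its
    normalization makes that constant 1. The normalization of the dual vector then gives the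
    pairing.\<close>
  then obtain c where c: "x (\<lambda>_. 0) - uea_const c \<in> I" by (rule Wt_lam)
  have "vev G lam (x (\<lambda>_. 0)) = 1"
    using w by (simp add: whittaker_ket_def x verma_pairing_eq)
  with vev_cong_I[OF c] have "c = 1" by (simp add: vev_const)
  have "vev G lam (y (\<lambda>_. 0)) = 1"
    using w' by (simp add: whittaker_bra_def y verma_pairing_eq)
  moreover have "vev G lam (y (\<lambda>_. 0) * x (\<lambda>_. 0)) = vev G lam (y (\<lambda>_. 0))"
    using I_mult[OF c, of "y (\<lambda>_. 0)"] by (intro vev_cong_I) (simp add: \<open>c = 1\<close> right_diff_distrib)
  ultimately show "P (\<lambda>_. 0) = 1" by (simp add: P)
qed

end

section \<open>The Whittaker function as a generating series of paths\<close>

theorem theorem3p9: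
  fixes G :: "('g::complex_lie_algebra, 'n::finite) chevalley"
    and lam :: "'n weight"
    and \<mu> \<mu>' :: "'n \<Rightarrow> complex"
    and w w' :: "('n \<Rightarrow> nat) \<Rightarrow> 'g uea set"
  assumes "chevalley_data G"
    and "generic_weight G lam"
    and "\<forall>i. \<mu> i \<noteq> 0" and "\<forall>i. \<mu>' i \<noteq> 0"
    and "whittaker_ket G lam \<mu> w"
    and "whittaker_bra G lam \<mu>' w'"
  shows "whittaker_function G lam w' w =
    exp_series
      (\<lambda>\<beta>. (\<Prod>i\<in>UNIV. (of_nat (dd G i) * \<mu> i * \<mu>' i) ^ \<beta> i) * path_partition G lam \<beta>)
      (\<lambda>\<beta>. wform_phi G (lam - qwt G \<beta>))"
proof -
  interpret verma_module G lam
    by unfold_locales (use assms in \<open>simp_all add: generic_weight_def\<close>)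
  let ?a = "\<lambda>i. of_nat (dd G i) * \<mu> i * \<mu>' i"
  let ?Z = "path_partition G lam"
  define P where "P \<beta> = verma_pairing G lam (w' \<beta>) (w \<beta>)" for \<beta>
  note rec = Whittaker_pairing[OF assms(5,6), folded P_def]
  have "P \<beta> = (\<Prod>i\<in>UNIV. ?a i ^ \<beta> i) * ?Z \<beta>" for \<beta>
  proof (induction \<beta> rule: measure_induct_rule[of "\<lambda>\<beta>. \<Sum>i\<in>UNIV. \<beta> i"])
    case (less \<beta>)
    show ?case
    proof (cases "\<beta> = (\<lambda>_. 0)")
      case True
      then show ?thesis by (simp add: rec(1) path_partition_0)
    next
      case False
      then have v: "vertex_weight G lam \<beta> \<noteq> 0" using assms(2) by (simp add: generic_weight_def)
      \<comment> \<open>The coefficient \<open>?a i\<close> is exactly the factor gained by the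
        product when \<beta> is reached from its i-th predecessor.\<close>
      have "?a i * lower i P \<beta> = (\<Prod>k\<in>UNIV. ?a k ^ \<beta> k) * lower i ?Z \<beta>" for i
      proof (cases rule: lower_cases[of \<beta> i])
        case zero
        then show ?thesis by (simp add: lower_eq_0)
      next
        case (step \<gamma>)
        have "P \<gamma> = (\<Prod>k\<in>UNIV. ?a k ^ \<gamma> k) * ?Z \<gamma>"
          by (rule less) (simp add: step sum_qstep)
        then show ?thesis unfolding lower_step[OF step] unfolding step prod_qstep by simp
      qed
      then have "vertex_weight G lam \<beta> * P \<beta> = (\<Prod>k\<in>UNIV. ?a k ^ \<beta> k) * (\<Sum>i\<in>UNIV. lower i ?Z \<beta>)"
        unfolding rec(2) by (simp add: sum_distrib_left)
      \<comment> \<open>Genericity permits division by the vertex weight, after which both sides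
        obey the same recursion.\<close>
      then show ?thesis using v by (simp add: path_partition_recursion[OF False] field_simps)
    qed
  qed
  then show ?thesis
    by (simp add: whittaker_function_def wform_phi_eq P_def)
qed

end
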